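(* Let $d\ge1$, $s\in(0,1)$, $\lambda,\Lambda>0$ and $\rho\ge0$. Let $u\in L^\infty(\mathbb R^d\times(-\infty,0])$ satisfy $$\partial_tu-\mathcal M_\rho^+u\le0\quad\text{and}\quad\partial_tu-\mathcal M_\rho^-u\ge0\quad\text{in }\mathbb R^d\times(-\infty,0]$$ in the viscosity sense. Then $u$ is constant in $\mathbb R^d\times(-\infty,0]$.
   Context: Notation: $B_R(x)=\{y\in\mathbb R^d:|x-y|<R\}$, $B_R=B_R(0)$. Kernels: with the convention that $\rho^{-d-2s}=\infty$ if $\rho=0$ (so $\min\{|y|^{-d-2s},\rho^{-d-2s}\}=|y|^{-d-2s}$), $\mathcal K_\rho$ is the set of all measurable $K:\mathbb R^d\to[0,\infty)$ such that (1) $K(y)\ge\lambda\min\{|y|^{-d-2s},\rho^{-d-2s}\}$ for all $y\ne0$; (2) $\int_{B_{2r}\setminus B_r}K(y)\,dy\le\Lambda r^{-2s}$ for all $r>0$; (3) if $s=1/2$, additionally $\int_{B_{2r}\setminus B_r}yK(y)\,dy=0$ for all $r>0$. Operators (acting in space): $\delta_yu(x)=u(x+y)-u(x)$ if $s<1/2$; $\delta_yu(x)=u(x+y)-u(x)-y\cdot\nabla u(x)\mathbf 1_{B_1}(y)$ if $s=1/2$; $\delta_yu(x)=u(x+y)-u(x)-y\cdot\nabla u(x)$ if $s>1/2$. $L_Ku(x)=\int_{\mathbb R^d}\delta_yu(x)K(y)\,dy$, $\mathcal M_\rho^-u(x)=\inf_{K\in\mathcal K_\rho}L_Ku(x)$,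 $\mathcal M_\rho^+u(x)=\sup_{K\in\mathcal K_\rho}L_Ku(x)$. It is tacitly assumed that $\mathcal K_\rho\neq\emptyset$. Since functions are evaluated pointwise, $L^\infty(\mathbb R^d\times I)$ means bounded Borel measurable functions defined everywhere. Viscosity sense: let $\Omega\subseteq\mathbb R^d$ be a domain, $I\subseteq(-\infty,0]$ a left-open interval, $f:\Omega\times I\to\mathbb R$, and let $F$ be $\mathcal M_\rho^+$ or $\mathcal M_\rho^-$; $\partial_t$ is the left derivative in time. A function $u\in L^\infty(\mathbb R^d\times I)$ that is upper semicontinuous in $\Omega\times I$ satisfies $\partial_tu-F(u)\le f$ in $\Omega\times I$ in the viscosity sense if for every $(x_0,t_0)\in\Omega\times I$, every $\varepsilon>0$ with $B_\varepsilon(x_0)\times(t_0-\varepsilon,t_0]\subseteq\Omega\times I$ and every $\varphi:B_\varepsilon(x_0)\times(t_0-\varepsilon,t_0]\to\mathbb R$ that is left-differentiable in time and $C^{1,1}$ in space with $u(x_0,t_0)=\varphi(x_0,t_0)$ and $u\le\varphi$ in $B_\varepsilon(x_0)\times(t_0-\varepsilon,t_0]$, the function $v$ equal to $\varphi$ in $B_\varepsilon(x_0)\times(t_0-\varepsilon,t_0]$ and to $u$ elsewhere in $\mathbb R^d\times I$ satisfies $\partial_tv(x_0,t_0)-F(v)(x_0,t_0)\le f(x_0,t_0)$. A function $u\in L^\infty(\mathbb R^d\times I)$ that is lower semicontinuous in $\Omega\times I$ satisfies $\partial_tu-F(u)\ge f$ in the viscosity sense if the same holds with $u\ge\varphi$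 in place of $u\le\varphi$ and $\partial_tv(x_0,t_0)-F(v)(x_0,t_0)\ge f(x_0,t_0)$ as conclusion. Here $\Omega=\mathbb R^d$, $I=(-\infty,0]$, $f=0$. *)

theory Defs
  imports "HOL-Analysis.Analysis"
begin

text \<open>Throughout, the dimension \<open>d\<close> is \<open>DIM('a)\<close>, and the lower ellipticity constant, usually written
  as a lower case lambda (reserved in HOL for abstraction), is \<open>\<kappa>\<close>.\<close>

section \<open>Kernels\<close>

text \<open>The case distinction implements the convention \<open>\<rho> powr (- d - 2 * s) = \<infinity>\<close> for \<open>\<rho> = 0\<close>;
  in HOL, \<open>0 powr a = 0\<close>.\<close>

definition kernel_lower_bound :: "real \<Rightarrow> real \<Rightarrow> 'a::euclidean_space \<Rightarrow> real" where
  "kernel_lower_bound s \<rho> y =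
    (if \<rho> = 0 then norm y powr (- real DIM('a) - 2 * s)
     else min (norm y powr (- real DIM('a) - 2 * s)) (\<rho> powr (- real DIM('a) - 2 * s)))"

text \<open>The bound on the annuli uses the nonnegative integral, so that it includes integrability of
  \<open>K\<close> there; hence the Bochner integral in the last condition is a genuine one.\<close>

definition kernels :: "real \<Rightarrow> real \<Rightarrow> real \<Rightarrow> real \<Rightarrow> ('a::euclidean_space \<Rightarrow> real) set" where
  "kernels s \<kappa> \<Lambda> \<rho> = {K.
     K \<in> borel_measurable lebesgue \<and>
     (\<forall>y. 0 \<le> K y) \<and>
     (\<forall>y. y \<noteq> 0 \<longrightarrow> \<kappa> * kernel_lower_bound s \<rho> y \<le> K y) \<and>
     (\<forall>r>0. (\<integral>\<^sup>+y\<in>(ball 0 (2 * r) - ball 0 r). ennreal (K y) \<partial>lebesgue) \<le> ennreal (\<Lambda> * r powr (- 2 * s))) \<and>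
     (s = 1/2 \<longrightarrow> (\<forall>r>0. (LINT y : (ball 0 (2 * r) - ball 0 r) | lebesgue. K y *\<^sub>R y) = 0))}"

section \<open>Operators\<close>

definition grad :: "('a::euclidean_space \<Rightarrow> real) \<Rightarrow> 'a \<Rightarrow> 'a" where
  "grad u x = (THE D. GDERIV u x :> D)"

definition delta :: "real \<Rightarrow> 'a::euclidean_space \<Rightarrow> ('a \<Rightarrow> real) \<Rightarrow> 'a \<Rightarrow> real" where
  "delta s y u x =
    (if s < 1/2 then u (x + y) - u x
     else if s = 1/2 then u (x + y) - u x - (y \<bullet> grad u x) * indicator (ball 0 1) y
     else u (x + y) - u x - y \<bullet> grad u x)"

definition nonlocal_op :: "real \<Rightarrow> ('a::euclidean_space \<Rightarrow> real) \<Rightarrow> ('a \<Rightarrow> real) \<Rightarrow> 'a \<Rightarrow> real" where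
  "nonlocal_op s K u x = (LINT y|lebesgue. delta s y u x * K y)"

text \<open>The supremum and the infimum are taken in the reals. They are meant for \<open>u\<close> bounded, Borel
  measurable and \<open>C^{1,1}\<close> near \<open>x\<close>, which is all that the viscosity notions below need. For
  such \<open>u\<close> and \<open>0 < s < 1\<close>, the bound on the annuli makes every \<open>nonlocal_op s K u x\<close> an absolutely
  convergent integral, bounded uniformly in \<open>K\<close>, so that both are the usual ones as soon as the
  set of kernels is nonempty.\<close>

definition pucci_inf ::
  "real \<Rightarrow> real \<Rightarrow> real \<Rightarrow> real \<Rightarrow> ('a::euclidean_space \<Rightarrow> real) \<Rightarrow> 'a \<Rightarrow> real" where
  "pucci_inf s \<kappa> \<Lambda> \<rho> u x = (INF K\<in>kernels s \<kappa> \<Lambda> \<rho>. nonlocal_op s K u x)"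

definition pucci_sup ::
  "real \<Rightarrow> real \<Rightarrow> real \<Rightarrow> real \<Rightarrow> ('a::euclidean_space \<Rightarrow> real) \<Rightarrow> 'a \<Rightarrow> real" where
  "pucci_sup s \<kappa> \<Lambda> \<rho> u x = (SUP K\<in>kernels s \<kappa> \<Lambda> \<rho>. nonlocal_op s K u x)"

section \<open>Viscosity solutions\<close>

text \<open>A function on \<open>\<real>\<^sup>d \<times> I\<close> is a total function of \<open>(x, t)\<close>; its values at times outside \<open>I\<close>
  play no role.\<close>

definition Linfty :: "('a::euclidean_space \<times> real) set \<Rightarrow> ('a \<times> real \<Rightarrow> real) set" where
  "Linfty S = {u. u \<in> borel_measurable (restrict_space borel S) \<and> bounded (u ` S)}"

definition usc_on :: "'b::topological_space set \<Rightarrow> ('b \<Rightarrow> real) \<Rightarrow> bool" where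
  "usc_on S u \<longleftrightarrow> (\<forall>z\<in>S. \<forall>c>u z. \<forall>\<^sub>F w in at z within S. u w < c)"

definition lsc_on :: "'b::topological_space set \<Rightarrow> ('b \<Rightarrow> real) \<Rightarrow> bool" where
  "lsc_on S u \<longleftrightarrow> (\<forall>z\<in>S. \<forall>c<u z. \<forall>\<^sub>F w in at z within S. c < u w)"

text \<open>On a ball, a function with Lipschitz gradient is bounded together with its gradient, so no
  bounds need to be required separately.\<close>

definition C11_on :: "'a::euclidean_space set \<Rightarrow> ('a \<Rightarrow> real) \<Rightarrow> bool" where
  "C11_on U f \<longleftrightarrow> (\<exists>G. (\<forall>x\<in>U. GDERIV f x :> G x) \<and> (\<exists>C. C-lipschitz_on U G))"

definition cylinder :: "real \<Rightarrow> 'a::euclidean_space \<Rightarrow> real \<Rightarrow> ('a \<times> real) set" where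
  "cylinder \<epsilon> x\<^sub>0 t\<^sub>0 = ball x\<^sub>0 \<epsilon> \<times> {t\<^sub>0 - \<epsilon><..t\<^sub>0}"

definition admissible_test :: "real \<Rightarrow> 'a::euclidean_space \<Rightarrow> real \<Rightarrow> ('a \<times> real \<Rightarrow> real) \<Rightarrow> bool" where
  "admissible_test \<epsilon> x\<^sub>0 t\<^sub>0 \<phi> \<longleftrightarrow>
    (\<forall>(x, t)\<in>cylinder \<epsilon> x\<^sub>0 t\<^sub>0. (\<lambda>\<tau>. \<phi> (x, \<tau>)) differentiable (at_left t)) \<and>
    (\<forall>t\<in>{t\<^sub>0 - \<epsilon><..t\<^sub>0}. C11_on (ball x\<^sub>0 \<epsilon>) (\<lambda>x. \<phi> (x, t)))"

definition glue ::
  "('a::euclidean_space \<times> real) set \<Rightarrow> ('a \<times> real \<Rightarrow> real) \<Rightarrow> ('a \<times> real \<Rightarrow> real) \<Rightarrow> 'a \<times> real \<Rightarrow> real" where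
  "glue Q \<phi> u z = (if z \<in> Q then \<phi> z else u z)"

definition parabolic_op ::
  "(('a::euclidean_space \<Rightarrow> real) \<Rightarrow> 'a \<Rightarrow> real) \<Rightarrow> ('a \<times> real \<Rightarrow> real) \<Rightarrow> 'a \<Rightarrow> real \<Rightarrow> real" where
  "parabolic_op F v x t = vector_derivative (\<lambda>\<tau>. v (x, \<tau>)) (at_left t) - F (\<lambda>x'. v (x', t)) x"

definition viscosity_le ::
  "(('a::euclidean_space \<Rightarrow> real) \<Rightarrow> 'a \<Rightarrow> real) \<Rightarrow> 'a set \<Rightarrow> real set \<Rightarrow> ('a \<times> real \<Rightarrow> real)
    \<Rightarrow> ('a \<times> real \<Rightarrow> real) \<Rightarrow> bool" where
  "viscosity_le F \<Omega> I f u \<longleftrightarrow>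
    u \<in> Linfty (UNIV \<times> I) \<and> usc_on (\<Omega> \<times> I) u \<and>
    (\<forall>x\<^sub>0\<in>\<Omega>. \<forall>t\<^sub>0\<in>I. \<forall>\<epsilon>>0. \<forall>\<phi>.
      cylinder \<epsilon> x\<^sub>0 t\<^sub>0 \<subseteq> \<Omega> \<times> I \<and> admissible_test \<epsilon> x\<^sub>0 t\<^sub>0 \<phi> \<and>
      u (x\<^sub>0, t\<^sub>0) = \<phi> (x\<^sub>0, t\<^sub>0) \<and> (\<forall>z\<in>cylinder \<epsilon> x\<^sub>0 t\<^sub>0. u z \<le> \<phi> z)
      \<longrightarrow> parabolic_op F (glue (cylinder \<epsilon> x\<^sub>0 t\<^sub>0) \<phi> u) x\<^sub>0 t\<^sub>0 \<le> f (x\<^sub>0, t\<^sub>0))"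

definition viscosity_ge ::
  "(('a::euclidean_space \<Rightarrow> real) \<Rightarrow> 'a \<Rightarrow> real) \<Rightarrow> 'a set \<Rightarrow> real set \<Rightarrow> ('a \<times> real \<Rightarrow> real)
    \<Rightarrow> ('a \<times> real \<Rightarrow> real) \<Rightarrow> bool" where
  "viscosity_ge F \<Omega> I f u \<longleftrightarrow>
    u \<in> Linfty (UNIV \<times> I) \<and> lsc_on (\<Omega> \<times> I) u \<and>
    (\<forall>x\<^sub>0\<in>\<Omega>. \<forall>t\<^sub>0\<in>I. \<forall>\<epsilon>>0. \<forall>\<phi>.
      cylinder \<epsilon> x\<^sub>0 t\<^sub>0 \<subseteq> \<Omega> \<times> I \<and> admissible_test \<epsilon> x\<^sub>0 t\<^sub>0 \<phi> \<and>
      u (x\<^sub>0, t\<^sub>0) = \<phi> (x\<^sub>0, t\<^sub>0) \<and> (\<forall>z\<in>cylinder \<epsilon> x\<^sub>0 t\<^sub>0. \<phi> z \<le> u z)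
      \<longrightarrow> f (x\<^sub>0, t\<^sub>0) \<le> parabolic_op F (glue (cylinder \<epsilon> x\<^sub>0 t\<^sub>0) \<phi> u) x\<^sub>0 t\<^sub>0)"

end

theory Submission
  imports Defs
begin

text \<open>
  Let \<open>a\<close> and \<open>b\<close> be the infimum and the supremum of \<open>u\<close> and suppose \<open>a < b\<close>. On the backward parabolic
  cylinder of radius \<open>R\<close> around the origin, the nonnegative functions \<open>u - a\<close> and \<open>b - u\<close> have mean values
  that add up to \<open>b - a\<close>, so for infinitely many \<open>R = 2 ^ n\<close> the same one of them has mean at least
  \<open>(b - a) / 2\<close>. Since \<open>- u\<close> satisfies the supersolution inequality as well
  (\<open>viscosity_le_imp_viscosity_ge_uminus\<close>), let it be \<open>u - a\<close>. The claim is then that \<open>u \<ge> a + \<delta>\<close>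
  everywhere, with a fixed \<open>\<delta> > 0\<close>, which contradicts the choice of \<open>a\<close>. Because the bounds \<open>a\<close> and \<open>b\<close> are
  global, a single improvement suffices and no iteration over scales takes place.

  The improvement is a weak Harnack inequality with an elementary proof, which is possible because every
  kernel is bounded below pointwise. At scales \<open>R \<ge> \<rho>\<close> a point within distance \<open>R / 2\<close> of the
  origin feels the mass of \<open>u - a\<close> in a cube of size \<open>R\<close> directly, with strength
  \<open>k = \<kappa> (2 R) powr (- d - 2 s)\<close>. So the lower bound of \<open>u - a\<close> near the origin grows at least
  like the solution of \<open>m' = k * (mass of u - a in the cube at time t) - c\<close>. The lemma
  \<open>viscosity_barrier\<close> makes this precise: \<open>u\<close> stays above \<open>a + m t - \<eta> min 1 (|x| / R)\<^sup>2\<close>. The drift \<open>c\<close>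
  pays for the capped paraboloid, on which each operator of the class costs at most a
  multiple of \<open>\<eta> R powr (- 2 s)\<close>. Since \<open>u\<close> is continuous, being semicontinuous from both sides,
  \<open>m\<close> is a classical antiderivative and the barrier is an admissible test function.

  Everything scales: over a time \<open>\<tau> R powr (2 s)\<close> the function \<open>m\<close> grows to at least \<open>\<eta> / 32\<close>, where
  \<open>\<eta>\<close> and \<open>\<tau>\<close> do not depend on \<open>R\<close> (\<open>lower_bound_at_scale\<close>). As \<open>R \<rightarrow> \<infinity>\<close> the paraboloid flattens
  out at every fixed point, and the bound \<open>u \<ge> a + \<eta> / 32\<close> is left (\<open>viscosity_improvement\<close>).
\<close>

section \<open>Moments of the kernels\<close>

lemma dyadic_shell_exists:
  fixes r :: real
  assumes "0 < r"
  shows "\<exists>n::nat. (2 ^ n \<le> r \<and> r < 2 * 2 ^ n) \<or> (1 / 2 ^ Suc n \<le> r \<and> r < 2 * (1 / 2 ^ Suc n))"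
proof -
  define k where "k = \<lfloor>log 2 r\<rfloor>"
  have k: "2 powr k \<le> r" "r < 2 powr (k + 1)"
    using assms floor_log_eq_powr_iff[of r 2 k] by (auto simp: k_def)
  show ?thesis
  proof (cases "k \<ge> 0")
    case True
    then have "2 powr (real_of_int k) = 2 ^ nat k" by (simp add: powr_real_of_int)
    with k show ?thesis by (intro exI[of _ "nat k"]) (auto simp: powr_add)
  next
    case False
    then have "2 powr (real_of_int k) = 1 / 2 ^ Suc (nat (- k - 1))"
      by (simp add: powr_real_of_int Suc_nat_eq_nat_zadd1 divide_inverse del: power_Suc)
    with k show ?thesis by (intro exI[of _ "nat (- k - 1)"]) (auto simp: powr_add)
  qed
qed

text \<open>Cut space into the dyadic shells of radii \<open>2\<^sup>k R\<close> with \<open>k\<close> an integer. On the shells outside the ball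
  of radius \<open>R\<close> the weight is at most the power \<open>q < 2 s\<close>, on the shells inside it is at most the power
  \<open>p > 2 s\<close>; against the mass \<open>(2\<^sup>k R) powr (- 2 s)\<close> of a shell, both halves are convergent geometric
  series, with sums proportional to \<open>R powr (- 2 s)\<close>.\<close>

lemma nn_integral_two_power_weight_le:
  fixes K :: "'a::euclidean_space \<Rightarrow> real"
  assumes K: "K \<in> borel_measurable lebesgue" "\<And>y. 0 \<le> K y"
    and annuli: "\<And>r. 0 < r \<Longrightarrow> (\<integral>\<^sup>+y\<in>(ball 0 (2 * r) - ball 0 r). ennreal (K y) \<partial>lebesgue)
                   \<le> ennreal (\<Lambda> * r powr (- 2 * s))"
    and pq: "0 \<le> q" "q < 2 * s" "2 * s < p" and R: "0 < R" and \<Lambda>: "0 \<le> \<Lambda>"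
  shows "(\<integral>\<^sup>+y. ennreal (min ((norm y / R) powr p) ((norm y / R) powr q) * K y) \<partial>lebesgue)
    \<le> ennreal (\<Lambda> * (2 powr q / (1 - 2 powr (q - 2 * s)) + 2 powr (2 * s) / (1 - 2 powr (2 * s - p)))
          * R powr (- 2 * s))"
proof -
  define A where "A r = ball (0::'a) (2 * r) - ball 0 r" for r
  define a where "a n = (2 * 2 ^ n :: real) powr q" for n :: nat
  define b where "b n = (2 * (1 / 2 ^ Suc n) :: real) powr p" for n :: nat
  define I where "I r = (\<integral>\<^sup>+y\<in>A r. ennreal (K y) \<partial>lebesgue)" for r
  define e where "e n = \<Lambda> * R powr (- 2 * s) * (2 powr q * (2 powr (q - 2 * s)) ^ n
      + 2 powr (2 * s) * (2 powr (2 * s - p)) ^ n)" for n :: nat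
  have [measurable]: "K \<in> borel_measurable lebesgue" by fact
  have [measurable]: "A r \<in> sets lebesgue" for r by (simp add: A_def)
  have p0: "0 < p" using pq by simp
  have pt: "ennreal (min ((norm y / R) powr p) ((norm y / R) powr q) * K y)
     \<le> (\<Sum>n. ennreal (a n) * (ennreal (K y) * indicator (A (2 ^ n * R)) y)
            + ennreal (b n) * (ennreal (K y) * indicator (A (1 / 2 ^ Suc n * R)) y))" for y
  proof (cases "y = 0")
    case True then show ?thesis by simp
  next
    case False
    define r where "r = norm y / R"
    have r: "0 < r" using False R by (simp add: r_def)
    obtain n where n: "(2 ^ n \<le> r \<and> r < 2 * 2 ^ n) \<or> (1 / 2 ^ Suc n \<le> r \<and> r < 2 * (1 / 2 ^ Suc n))"
      using dyadic_shell_exists[OF r] by blast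
    have A: "y \<in> A (c * R) \<longleftrightarrow> c \<le> r \<and> r < 2 * c" for c
      using R by (auto simp: A_def r_def field_simps)
    let ?f = "\<lambda>n. ennreal (a n) * (ennreal (K y) * indicator (A (2 ^ n * R)) y)
            + ennreal (b n) * (ennreal (K y) * indicator (A (1 / 2 ^ Suc n * R)) y)"
    have "ennreal (min (r powr p) (r powr q) * K y) \<le> ?f n"
      using n
    proof
      assume *: "2 ^ n \<le> r \<and> r < 2 * 2 ^ n"
      then have "min (r powr p) (r powr q) \<le> a n"
        unfolding a_def using r pq by (intro min.coboundedI2 powr_mono2) auto
      then have "ennreal (min (r powr p) (r powr q) * K y) \<le> ennreal (a n) * ennreal (K y)"
        using K(2)[of y] by (subst ennreal_mult[symmetric]) (auto intro!: ennreal_leI mult_right_mono simp: a_def)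
      also have "\<dots> \<le> ?f n" using * A[of "2 ^ n"] by (simp add: indicator_def)
      finally show ?thesis .
    next
      assume *: "1 / 2 ^ Suc n \<le> r \<and> r < 2 * (1 / 2 ^ Suc n)"
      then have "min (r powr p) (r powr q) \<le> b n"
        unfolding b_def using r p0 by (intro min.coboundedI1 powr_mono2) auto
      then have "ennreal (min (r powr p) (r powr q) * K y) \<le> ennreal (b n) * ennreal (K y)"
        using K(2)[of y] by (subst ennreal_mult[symmetric]) (auto intro!: ennreal_leI mult_right_mono simp: b_def)
      also have "\<dots> \<le> ?f n" using * A[of "1 / 2 ^ Suc n"] by (simp add: indicator_def)
      finally show ?thesis .
    qed
    also have "?f n \<le> suminf ?f"
      using sum_le_suminf[of ?f "{n}"] by simp
    finally show ?thesis unfolding r_def .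
  qed
  have "(\<integral>\<^sup>+y. ennreal (min ((norm y / R) powr p) ((norm y / R) powr q) * K y) \<partial>lebesgue)
     \<le> (\<integral>\<^sup>+y. (\<Sum>n. ennreal (a n) * (ennreal (K y) * indicator (A (2 ^ n * R)) y)
            + ennreal (b n) * (ennreal (K y) * indicator (A (1 / 2 ^ Suc n * R)) y)) \<partial>lebesgue)"
    by (intro nn_integral_mono pt)
  also have "\<dots> = (\<Sum>n. ennreal (a n) * I (2 ^ n * R) + ennreal (b n) * I (1 / 2 ^ Suc n * R))"
    by (subst nn_integral_suminf, measurable) (simp add: nn_integral_add nn_integral_cmult I_def)
  also have "\<dots> \<le> (\<Sum>n. ennreal (e n))"
  proof (intro suminf_le summableI)
    fix n
    have "ennreal (a n) * I (2 ^ n * R) + ennreal (b n) * I (1 / 2 ^ Suc n * R)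
      \<le> ennreal (a n) * ennreal (\<Lambda> * (2 ^ n * R) powr (- 2 * s))
         + ennreal (b n) * ennreal (\<Lambda> * (1 / 2 ^ Suc n * R) powr (- 2 * s))"
      unfolding I_def A_def using R by (intro add_mono mult_left_mono annuli) auto
    also have "\<dots> = ennreal (a n * (\<Lambda> * (2 ^ n * R) powr (- 2 * s))
         + b n * (\<Lambda> * (1 / 2 ^ Suc n * R) powr (- 2 * s)))"
      using \<Lambda> by (simp add: ennreal_mult a_def b_def)
    also have "a n * (\<Lambda> * (2 ^ n * R) powr (- 2 * s)) + b n * (\<Lambda> * (1 / 2 ^ Suc n * R) powr (- 2 * s)) = e n"
    proof -
      have two: "(2::real) ^ n = 2 powr real n" by (simp add: powr_realpow)
      have "a n = 2 powr (q + real n * q)" "(2 ^ n * R) powr (- 2 * s) = 2 powr (- 2 * s * real n) * R powr (- 2 * s)"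
        "(2 powr (q - 2 * s)) ^ n = 2 powr ((q - 2 * s) * real n)"
        unfolding a_def two using R by (simp_all add: powr_mult powr_add powr_powr powr_power mult.commute)
      moreover have "2 powr (q + real n * q) * 2 powr (- 2 * s * real n) = 2 powr q * 2 powr ((q - 2 * s) * real n)"
        unfolding powr_add[symmetric] by (simp add: algebra_simps)
      ultimately have A: "a n * (2 ^ n * R) powr (- 2 * s) = R powr (- 2 * s) * (2 powr q * (2 powr (q - 2 * s)) ^ n)"
        by (simp only: mult_ac)
      have half: "(1 / 2 ^ Suc n :: real) = 2 powr (- real n - 1)"
        by (simp add: powr_diff powr_minus two divide_simps)
      have "b n = 2 powr (- real n * p)"
        unfolding b_def half by (simp add: powr_mult_base powr_powr)
      moreover have "(1 / 2 ^ Suc n * R) powr (- 2 * s) = 2 powr ((- real n - 1) * (- 2 * s)) * R powr (- 2 * s)"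
        unfolding half using R by (simp add: powr_mult powr_powr)
      moreover have "(2 powr (2 * s - p)) ^ n = 2 powr ((2 * s - p) * real n)"
        by (simp add: powr_power mult.commute)
      moreover have "2 powr (- real n * p) * 2 powr ((- real n - 1) * (- 2 * s))
          = 2 powr (2 * s) * 2 powr ((2 * s - p) * real n)"
        unfolding powr_add[symmetric] by (simp add: algebra_simps)
      ultimately have B: "b n * (1 / 2 ^ Suc n * R) powr (- 2 * s)
          = R powr (- 2 * s) * (2 powr (2 * s) * (2 powr (2 * s - p)) ^ n)"
        by (simp only: mult_ac)
      show ?thesis unfolding e_def distrib_left mult.left_commute[of _ \<Lambda>] A B by (simp only: mult_ac)
    qed
    finally show "ennreal (a n) * I (2 ^ n * R) + ennreal (b n) * I (1 / 2 ^ Suc n * R) \<le> ennreal (e n)" .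
  qed
  also have "\<dots> = ennreal (\<Sum>n. e n)"
  proof (rule suminf_ennreal2)
    show "summable e" unfolding e_def using pq
      by (intro summable_mult summable_add summable_geometric) (auto simp: powr_less_one)
    show "0 \<le> e n" for n using \<Lambda> by (auto simp: e_def)
  qed
  also have "(\<Sum>n. e n) = \<Lambda> * (2 powr q / (1 - 2 powr (q - 2 * s)) + 2 powr (2 * s) / (1 - 2 powr (2 * s - p)))
          * R powr (- 2 * s)"
  proof -
    have "e sums (\<Lambda> * R powr (- 2 * s) * (2 powr q * (1 / (1 - 2 powr (q - 2 * s)))
       + 2 powr (2 * s) * (1 / (1 - 2 powr (2 * s - p)))))"
      unfolding e_def using pq
      by (intro sums_mult sums_add geometric_sums) (auto simp: powr_less_one)
    then show ?thesis by (simp add: sums_iff)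
  qed
  finally show ?thesis .
qed

text \<open>A \<open>C\<^sup>1\<^sup>,\<^sup>1\<close> function that varies on the scale \<open>R\<close> by an amount of order one has increments
  bounded by a multiple of this weight, once they are corrected by the gradient as the value of \<open>s\<close>
  demands. The exponents lie on the two sides of \<open>2 s\<close>, so that the weight has a finite integral against
  every kernel.\<close>

definition jump_weight :: "real \<Rightarrow> real \<Rightarrow> 'a::euclidean_space \<Rightarrow> real" where
  "jump_weight s R y =
    min ((norm y / R) powr (if s < 1/2 then 1 else 2)) ((norm y / R) powr (if s \<le> 1/2 then 0 else 1))"

lemma jump_weight_nonneg: "0 \<le> jump_weight s R y"
  by (simp add: jump_weight_def)

lemma jump_weight_inside:
  assumes "norm y < R"
  shows "jump_weight s R y = (if s < 1/2 then norm y / R else (norm y / R)\<^sup>2)"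
proof (cases "y = 0")
  case False
  then have R: "0 < R" and r: "0 < norm y / R" "norm y / R < 1"
    using assms le_less_trans[OF norm_ge_zero assms] by auto
  have "(norm y / R) powr b \<le> (norm y / R) powr a" if "a \<le> b" for a b
    using powr_mono'[of a b "norm y / R"] r that by simp
  then have "jump_weight s R y = (norm y / R) powr (if s < 1/2 then 1 else 2)"
    unfolding jump_weight_def by (intro min_absorb1) auto
  also have "\<dots> = (if s < 1/2 then norm y / R else (norm y / R)\<^sup>2)"
    using r R by (simp)
  finally show ?thesis .
qed (simp add: jump_weight_def)

lemma jump_weight_outside:
  assumes "R \<le> norm y" "0 < R"
  shows "jump_weight s R y = (if s \<le> 1/2 then 1 else norm y / R)"
proof -
  have r: "1 \<le> norm y / R" using assms by simp
  have "(norm y / R) powr a \<le> (norm y / R) powr b" if "a \<le> b" for a b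
    using powr_mono[of a b "norm y / R"] r that by simp
  then have "jump_weight s R y = (norm y / R) powr (if s \<le> 1/2 then 0 else 1)"
    unfolding jump_weight_def by (intro min_absorb2) auto
  also have "\<dots> = (if s \<le> 1/2 then 1 else norm y / R)"
    using assms by (auto simp: powr_zero_eq_one)
  finally show ?thesis .
qed

lemma jump_weight_measurable [measurable]: "jump_weight s R \<in> borel_measurable borel"
  unfolding jump_weight_def by measurable

lemma kernels_jump_weight:
  assumes "0 < s" "s < 1" "0 \<le> \<Lambda>"
  shows "\<exists>C\<ge>0. \<forall>(K::'a::euclidean_space \<Rightarrow> real) \<in> kernels s \<kappa> \<Lambda> \<rho>. \<forall>R>0.
     integrable lebesgue (\<lambda>y. jump_weight s R y * K y) \<and>
     (LINT y|lebesgue. jump_weight s R y * K y) \<le> C * R powr (- 2 * s)"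
proof -
  define p where "p = (if s < 1/2 then 1 else 2::real)"
  define q where "q = (if s \<le> 1/2 then 0 else 1::real)"
  have pq: "0 \<le> q" "q < 2 * s" "2 * s < p" using assms by (auto simp: p_def q_def)
  define C where "C = \<Lambda> * (2 powr q / (1 - 2 powr (q - 2 * s)) + 2 powr (2 * s) / (1 - 2 powr (2 * s - p)))"
  have "2 powr (q - 2 * s) < 1" "2 powr (2 * s - p) < 1" using pq by (auto simp: powr_less_one)
  then have C: "0 \<le> C" using assms by (auto simp: C_def)
  show ?thesis
  proof (intro exI[of _ C] conjI C ballI allI impI)
    fix K :: "'a \<Rightarrow> real" and R :: real
    assume K: "K \<in> kernels s \<kappa> \<Lambda> \<rho>" and R: "0 < R"
    have Km [measurable]: "K \<in> borel_measurable lebesgue" and K0: "\<And>y. 0 \<le> K y"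
      using K by (auto simp: kernels_def)
    have nn: "(\<integral>\<^sup>+y. ennreal (jump_weight s R y * K y) \<partial>lebesgue) \<le> ennreal (C * R powr (- 2 * s))"
      using nn_integral_two_power_weight_le[OF Km K0 _ pq R assms(3)] K
      unfolding jump_weight_def C_def p_def[symmetric] q_def[symmetric]
      by (auto simp: kernels_def)
    have [measurable]: "jump_weight s R \<in> borel_measurable lebesgue"
      by (intro measurable_completion) simp
    show "integrable lebesgue (\<lambda>y. jump_weight s R y * K y)"
      using nn K0 jump_weight_nonneg[of s R]
      by (intro integrableI_nonneg) (auto intro: le_less_trans intro!: AE_I2 mult_nonneg_nonneg)
    show "(LINT y|lebesgue. jump_weight s R y * K y) \<le> C * R powr (- 2 * s)"
      using nn C K0 jump_weight_nonneg[of s R]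
      by (subst integral_eq_nn_integral) (auto intro!: enn2real_leI AE_I2 mult_nonneg_nonneg)
  qed
qed

text \<open>In the critical case \<open>s = 1/2\<close> the gradient is subtracted on the unit ball only. The cancellation
  condition on the annuli allows the unit ball to be exchanged for a larger one, provided that its radius
  is a power of two. This is the reason for working with the radii \<open>2 ^ n\<close> throughout.\<close>

lemma kernels_half_first_moment:
  fixes K :: "'a::euclidean_space \<Rightarrow> real"
  assumes K: "K \<in> kernels (1/2) \<kappa> \<Lambda> \<rho>"
  shows "set_integrable lebesgue (ball 0 (2 ^ n) - ball 0 1) (\<lambda>y. K y *\<^sub>R y) \<and>
     (LINT y : (ball 0 (2 ^ n) - ball 0 1) | lebesgue. K y *\<^sub>R y) = 0"
proof (induction n)
  case 0
  show ?case by (simp add: set_integrable_def set_lebesgue_integral_def)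
next
  case (Suc n)
  have Km [measurable]: "K \<in> borel_measurable lebesgue" and K0: "\<And>y. 0 \<le> K y"
    using K by (auto simp: kernels_def)
  let ?r = "2 ^ n :: real"
  let ?S = "ball (0::'a) (2 * ?r) - ball 0 ?r"
  have split: "ball (0::'a) (2 ^ Suc n) - ball 0 1 = (ball 0 ?r - ball 0 1) \<union> ?S"
    using subset_ball[of 1 ?r "0::'a"] subset_ball[of ?r "2 * ?r" "0::'a"] by (simp, blast)
  have "set_integrable lebesgue ?S (\<lambda>y. K y *\<^sub>R y)"
    unfolding set_integrable_def
  proof (rule integrableI_bounded)
    have "(\<lambda>y::'a. y) \<in> borel_measurable lebesgue"
      by (intro measurable_completion) simp
    have S: "?S \<in> sets lebesgue" by simp
    show "(\<lambda>y. indicator ?S y *\<^sub>R K y *\<^sub>R y) \<in> borel_measurable lebesgue"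
      by (intro borel_measurable_scaleR borel_measurable_indicator S Km) fact
    have "(\<integral>\<^sup>+y. ennreal (norm (indicator ?S y *\<^sub>R K y *\<^sub>R y)) \<partial>lebesgue)
        \<le> (\<integral>\<^sup>+y. ennreal (2 * ?r) * (ennreal (K y) * indicator ?S y) \<partial>lebesgue)"
      using K0 by (intro nn_integral_mono)
        (auto simp: indicator_def ennreal_mult[symmetric] mult.commute intro!: ennreal_leI mult_left_mono)
    also have "\<dots> = ennreal (2 * ?r) * (\<integral>\<^sup>+y\<in>?S. ennreal (K y) \<partial>lebesgue)"
      using S by (intro nn_integral_cmult borel_measurable_times_ennreal borel_measurable_indicator) auto
    also have "\<dots> \<le> ennreal (2 * ?r) * ennreal (\<Lambda> * ?r powr (- 2 * (1/2)))"
      using K unfolding kernels_def by (intro mult_left_mono) auto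
    also have "\<dots> < \<infinity>" by (simp add: ennreal_mult_less_top)
    finally show "(\<integral>\<^sup>+y. ennreal (norm (indicator ?S y *\<^sub>R K y *\<^sub>R y)) \<partial>lebesgue) < \<infinity>" .
  qed
  moreover have "(LINT y : ?S | lebesgue. K y *\<^sub>R y) = 0"
    using K unfolding kernels_def by auto
  moreover have "(ball (0::'a) ?r - ball 0 1) \<inter> ?S = {}" by auto
  ultimately show ?case
    unfolding split using Suc.IH by (simp add: set_integral_Un set_integrable_Un)
qed

section \<open>The nonlocal operator at a contact point with a paraboloid\<close>

text \<open>The capped paraboloid \<open>min 1 |x|\<^sup>2\<close> is semiconcave: it lies below the paraboloid, which controls
  its increments for short jumps, and below one, which controls them for long jumps. Only this upper
  bound on its increments matters, and so its kink at \<open>|x| = 1\<close> is harmless.\<close>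

lemma capped_square_increment_le:
  fixes \<xi> z :: "'a::euclidean_space"
  assumes \<xi>: "norm \<xi> \<le> 1/2"
  shows "min 1 ((norm (\<xi> + z))\<^sup>2) - (norm \<xi>)\<^sup>2
     - 2 * (\<xi> \<bullet> z) * (if s < 1/2 then 0 else if s = 1/2 then indicator (ball 0 1) z else 1)
     \<le> 2 * jump_weight s 1 z"
proof -
  have sq: "(norm (\<xi> + z))\<^sup>2 = (norm \<xi>)\<^sup>2 + 2 * (\<xi> \<bullet> z) + (norm z)\<^sup>2"
    by (simp add: power2_norm_eq_inner inner_add_left inner_add_right inner_commute)
  have cs: "\<bar>2 * (\<xi> \<bullet> z)\<bar> \<le> norm z"
    using Cauchy_Schwarz_ineq2[of \<xi> z] mult_right_mono[OF \<xi>, of "norm z"] by (simp add: abs_mult)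
  show ?thesis
  proof (cases "norm z < 1")
    case True
    then have "(norm z)\<^sup>2 \<le> norm z" by (simp add: power2_eq_square mult_left_le)
    moreover have "min 1 ((norm (\<xi> + z))\<^sup>2) \<le> (norm (\<xi> + z))\<^sup>2" by simp
    moreover have "0 \<le> (norm z)\<^sup>2" by simp
    ultimately have *: "min 1 ((norm (\<xi> + z))\<^sup>2) - (norm \<xi>)\<^sup>2 - 2 * (\<xi> \<bullet> z) * (if s < 1/2 then 0 else 1)
        \<le> 2 * (if s < 1/2 then norm z else (norm z)\<^sup>2)"
      using cs sq by (cases "s < 1/2"; simp only: if_True if_False mult_zero_right mult_1_right; linarith)
    have "(if s < 1/2 then 0 else if s = 1/2 then indicator (ball 0 1) z else 1)
        = (if s < 1/2 then 0 else 1 :: real)" using True by simp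
    moreover have "jump_weight s 1 z = (if s < 1/2 then norm z else (norm z)\<^sup>2)"
      using jump_weight_inside[OF True, of s] by simp
    ultimately show ?thesis using * by (simp only:)
  next
    case False
    have "min 1 ((norm (\<xi> + z))\<^sup>2) - (norm \<xi>)\<^sup>2 \<le> 1"
      using zero_le_power2[of "norm \<xi>"] min.cobounded1[of 1 "(norm (\<xi> + z))\<^sup>2"] by linarith
    then show ?thesis using False cs by (auto simp: jump_weight_outside)
  qed
qed

lemma GDERIV_paraboloid:
  "GDERIV (\<lambda>x::'a::euclidean_space. c - \<eta> * (norm x / R)\<^sup>2) x :> - (2 * \<eta> / R\<^sup>2) *\<^sub>R x"
proof -
  have "((\<lambda>x. c - k * (x \<bullet> x)) has_derivative (\<lambda>h. h \<bullet> (- (2 * k) *\<^sub>R x))) (at x)" for k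
    by (auto intro!: derivative_eq_intros simp: inner_commute algebra_simps)
  from this[of "\<eta> / R\<^sup>2"] show ?thesis
    by (simp add: gderiv_def power_divide power2_norm_eq_inner)
qed

lemma GDERIV_unique:
  assumes "GDERIV f x :> D" "GDERIV f x :> E"
  shows "D = E"
proof -
  have "(\<lambda>h. h \<bullet> D) = (\<lambda>h. h \<bullet> E)"
    using assms has_derivative_unique unfolding gderiv_def by blast
  then have "\<forall>h. h \<bullet> D = h \<bullet> E" by (simp add: fun_eq_iff)
  then show ?thesis using vector_eq_ldot by blast
qed

lemma grad_eqI: "GDERIV u x :> D \<Longrightarrow> grad u x = D"
  unfolding grad_def by (blast intro: GDERIV_unique)

lemma GDERIV_transform_within_open:
  assumes "GDERIV f x :> D" "open S" "x \<in> S" "\<And>y. y \<in> S \<Longrightarrow> f y = g y"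
  shows "GDERIV g x :> D"
  using assms unfolding gderiv_def by (rule has_derivative_transform_within_open)

text \<open>The increment \<^const>\<open>delta\<close> with the gradient cut off at radius \<open>R\<close> in place of \<open>1\<close> when
  \<open>s = 1/2\<close>.\<close>

definition rescaled_delta :: "real \<Rightarrow> real \<Rightarrow> 'a::euclidean_space \<Rightarrow> ('a \<Rightarrow> real) \<Rightarrow> 'a \<Rightarrow> real" where
  "rescaled_delta s R y v x = v (x + y) - v x
     - (y \<bullet> grad v x) * (if s < 1/2 then 0 else if s = 1/2 then indicator (ball 0 R) y else 1)"

lemma nonlocal_op_eq_rescaled:
  fixes v :: "'a::euclidean_space \<Rightarrow> real"
  assumes K: "K \<in> kernels s \<kappa> \<Lambda> \<rho>"
    and int: "integrable lebesgue (\<lambda>y. rescaled_delta s (2 ^ n) y v x * K y)"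
  shows "nonlocal_op s K v x = (LINT y|lebesgue. rescaled_delta s (2 ^ n) y v x * K y)"
proof (cases "s = 1/2")
  case False
  then have "delta s y v x = rescaled_delta s (2 ^ n) y v x" for y
    by (auto simp: delta_def rescaled_delta_def)
  then show ?thesis by (simp add: nonlocal_op_def)
next
  case True
  let ?S = "ball (0::'a) (2 ^ n) - ball 0 1" and ?g = "grad v x"
  have fm: "set_integrable lebesgue ?S (\<lambda>y. K y *\<^sub>R y)"
     "(LINT y : ?S | lebesgue. K y *\<^sub>R y) = 0"
    using kernels_half_first_moment[of K \<kappa> \<Lambda> \<rho> n] K True by auto
  then have i0: "integrable lebesgue (\<lambda>y. (indicator ?S y *\<^sub>R K y *\<^sub>R y) \<bullet> ?g)"
    unfolding set_integrable_def by (intro integrable_inner_left) simp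
  have z: "(LINT y|lebesgue. (indicator ?S y *\<^sub>R K y *\<^sub>R y) \<bullet> ?g) = 0"
    using fm unfolding set_integrable_def set_lebesgue_integral_def
    by (subst integral_inner_left) (simp_all only: inner_zero_left)
  have "ball (0::'a) 1 \<subseteq> ball 0 (2 ^ n)" by (intro subset_ball) simp
  then have "delta s y v x * K y
     = rescaled_delta s (2 ^ n) y v x * K y + (indicator ?S y *\<^sub>R K y *\<^sub>R y) \<bullet> ?g" for y
    using True by (auto simp: delta_def rescaled_delta_def indicator_def algebra_simps)
  then show ?thesis unfolding nonlocal_op_def
    using int i0 z by simp
qed

lemma kernels_lower_bound_on_ball:
  fixes K :: "'a::euclidean_space \<Rightarrow> real"
  assumes K: "K \<in> kernels s \<kappa> \<Lambda> \<rho>" and "0 < s" "0 < \<kappa>" "0 \<le> \<rho>" "\<rho> \<le> r" "y \<noteq> 0" "norm y \<le> r"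
  shows "\<kappa> * r powr (- real DIM('a) - 2 * s) \<le> K y"
proof -
  have "r powr (- real DIM('a) - 2 * s) \<le> kernel_lower_bound s \<rho> y"
    using assms by (auto simp: kernel_lower_bound_def intro!: powr_mono2')
  then show ?thesis using K assms unfolding kernels_def
    by (smt (verit) mem_Collect_eq mult_left_mono)
qed

text \<open>Let \<open>P\<close> be the capped paraboloid that touches \<open>v\<close> from below at \<open>x\<^sub>0\<close>. The increment of \<open>v\<close> is that of
  \<open>P\<close> plus \<open>v - P\<close>, which is nonnegative. The increments of \<open>P\<close> cost at most \<open>2 * \<eta>\<close> times the moment of
  \<^const>\<open>jump_weight\<close>. For the nonnegative part the kernel may be replaced by its lower bound, and the
  jumps into \<open>Q\<close>, of length at most \<open>2 * R\<close>, collect the integral of \<open>v - P \<ge> v - c\<close> there.\<close>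

lemma nonlocal_op_ge:
  fixes v :: "'a::euclidean_space \<Rightarrow> real"
  assumes K: "K \<in> kernels s \<kappa> \<Lambda> \<rho>" and s: "0 < s" "s < 1" and \<kappa>: "0 < \<kappa>" and \<rho>: "0 \<le> \<rho>" "\<rho> \<le> R"
    and R: "R = 2 ^ n"
    and W: "\<And>r. 0 < r \<Longrightarrow> integrable lebesgue (\<lambda>y. jump_weight s r y * K y)"
    and v [measurable]: "v \<in> borel_measurable borel" and B: "\<And>x. \<bar>v x\<bar> \<le> B"
    and \<epsilon>: "0 < \<epsilon>" and x\<^sub>0: "norm x\<^sub>0 \<le> R / 2" and \<eta>: "0 \<le> \<eta>"
    and near: "\<And>x. x \<in> ball x\<^sub>0 \<epsilon> \<Longrightarrow> v x = c - \<eta> * (norm x / R)\<^sup>2"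
    and below: "\<And>x. c - \<eta> * min 1 ((norm x / R)\<^sup>2) \<le> v x"
    and Q: "Q \<subseteq> cball 0 R" "Q \<in> sets borel"
  shows "\<kappa> * (2 * R) powr (- real DIM('a) - 2 * s) * (LINT z:Q|lborel. v z - c)
          - 2 * \<eta> * (LINT y|lebesgue. jump_weight s R y * K y) \<le> nonlocal_op s K v x\<^sub>0"
proof -
  have Rpos: "0 < R" by (simp add: R)
  have Km [measurable]: "K \<in> borel_measurable lebesgue" and K0: "\<And>y. 0 \<le> K y"
    using K by (auto simp: kernels_def)
  define \<theta> where "\<theta> y = (if s < 1/2 then 0 else if s = 1/2 then indicator (ball 0 R) y else 1 :: real)" for y :: 'a
  define E where "E y = rescaled_delta s R y v x\<^sub>0" for y
  define b where "b = (2 * \<eta> / R\<^sup>2) *\<^sub>R x\<^sub>0"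
  define P where "P x = c - \<eta> * min 1 ((norm x / R)\<^sup>2)" for x :: 'a
  define k where "k = \<kappa> * (2 * R) powr (- real DIM('a) - 2 * s)"
  have g: "grad v x\<^sub>0 = - b"
    unfolding b_def
    using \<epsilon> near by (subst grad_eqI[OF GDERIV_transform_within_open[OF GDERIV_paraboloid[of c \<eta> R], of "ball x\<^sub>0 \<epsilon>"]]) auto
  have E: "E y = v (x\<^sub>0 + y) - v x\<^sub>0 + (y \<bullet> b) * \<theta> y" for y
    by (simp add: E_def rescaled_delta_def g \<theta>_def)
  have \<xi>: "norm (x\<^sub>0 /\<^sub>R R) \<le> 1/2" using x\<^sub>0 Rpos by (simp add: field_simps)
  have v0: "v x\<^sub>0 = c - \<eta> * (norm (x\<^sub>0 /\<^sub>R R))\<^sup>2" "v x\<^sub>0 = P x\<^sub>0"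
  proof -
    have "(norm x\<^sub>0 / R)\<^sup>2 \<le> 1" using \<xi> Rpos by (intro power_le_one) (auto simp: field_simps)
    then show "v x\<^sub>0 = c - \<eta> * (norm (x\<^sub>0 /\<^sub>R R))\<^sup>2" "v x\<^sub>0 = P x\<^sub>0"
      using near[of x\<^sub>0] \<epsilon> Rpos by (auto simp: P_def divide_inverse mult.commute)
  qed
  have E_lower: "v (x\<^sub>0 + y) - P (x\<^sub>0 + y) - 2 * \<eta> * jump_weight s R y \<le> E y" for y
  proof -
    let ?\<xi> = "x\<^sub>0 /\<^sub>R R" and ?z = "y /\<^sub>R R"
    have w: "jump_weight s 1 ?z = jump_weight s R y"
    proof -
      have "norm ?z / 1 = norm y / R" using Rpos by (simp add: divide_inverse mult.commute)
      then show ?thesis unfolding jump_weight_def by (simp only:)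
    qed
    have \<theta>': "(if s < 1/2 then 0 else if s = 1/2 then indicator (ball 0 1) ?z else 1) = \<theta> y"
      using Rpos by (simp add: \<theta>_def indicator_def field_simps)
    have i: "2 * (?\<xi> \<bullet> ?z) * \<eta> = y \<bullet> b"
      by (simp add: b_def inner_commute power2_eq_square divide_inverse)
    have n: "norm (?\<xi> + ?z) = norm (x\<^sub>0 + y) / R"
      using Rpos by (simp add: divide_inverse mult.commute flip: scaleR_add_right)
    have "\<eta> * (min 1 ((norm (x\<^sub>0 + y) / R)\<^sup>2) - (norm ?\<xi>)\<^sup>2 - 2 * (?\<xi> \<bullet> ?z) * \<theta> y) \<le> \<eta> * (2 * jump_weight s R y)"
      using capped_square_increment_le[OF \<xi>, of ?z s] unfolding w \<theta>' n
      by (intro mult_left_mono \<eta>)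
    then have "\<eta> * min 1 ((norm (x\<^sub>0 + y) / R)\<^sup>2) - \<eta> * (norm ?\<xi>)\<^sup>2 - (y \<bullet> b) * \<theta> y \<le> 2 * \<eta> * jump_weight s R y"
      unfolding i[symmetric] by (simp add: algebra_simps)
    then show ?thesis unfolding E v0(1) P_def by simp
  qed
  \<comment> \<open>Integrability uses the weight at a radius so small that \<open>v\<close> is a paraboloid within it: outside,
     where only boundedness is known, that weight is bounded below.\<close>
  have [measurable]: "\<theta> \<in> borel_measurable borel"
    unfolding \<theta>_def by (cases "s < 1/2"; cases "s = 1/2") (simp_all add: borel_measurable_indicator)
  have "(\<lambda>y. E y) \<in> borel_measurable borel"
    unfolding E by measurable
  have Em [measurable]: "E \<in> borel_measurable lebesgue"
    using \<open>(\<lambda>y. E y) \<in> borel_measurable borel\<close> by (intro measurable_completion) simp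
  define r where "r = min \<epsilon> R"
  have r: "0 < r" "r \<le> \<epsilon>" "r \<le> R" using \<epsilon> Rpos by (auto simp: r_def)
  define C where "C = \<eta> / R\<^sup>2 * (r * r + 2 * norm x\<^sub>0 * r) + 2 * B + norm b * R + norm b * r"
  have B0: "0 \<le> B" using B[of 0] by linarith
  have E_upper: "\<bar>E y\<bar> \<le> C * jump_weight s r y" for y
  proof (cases "norm y < r")
    case True
    then have vy: "v (x\<^sub>0 + y) = c - \<eta> * (norm (x\<^sub>0 + y) / R)\<^sup>2" "v x\<^sub>0 = c - \<eta> * (norm x\<^sub>0 / R)\<^sup>2"
      using near[of "x\<^sub>0 + y"] near[of x\<^sub>0] r \<epsilon> by (auto simp: dist_norm)
    have d: "v (x\<^sub>0 + y) - v x\<^sub>0 = - (y \<bullet> b) - \<eta> / R\<^sup>2 * (norm y)\<^sup>2"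
      unfolding vy b_def
      by (simp add: power_divide power2_norm_eq_inner inner_add_left inner_add_right inner_commute
          diff_divide_distrib add_divide_distrib algebra_simps)
    show ?thesis
    proof (cases "s < 1/2")
      case s: True
      have "\<bar>y \<bullet> b\<bar> \<le> \<eta> / R\<^sup>2 * (2 * norm x\<^sub>0) * norm y"
        using Cauchy_Schwarz_ineq2[of y b] \<eta> by (simp add: b_def mult_ac)
      moreover have "\<eta> / R\<^sup>2 * (norm y)\<^sup>2 \<le> \<eta> / R\<^sup>2 * r * norm y"
      proof -
        have "(norm y)\<^sup>2 \<le> r * norm y"
          using True by (simp add: power2_eq_square mult_right_mono)
        from mult_left_mono[OF this, of "\<eta> / R\<^sup>2"] \<eta> show ?thesis by (simp add: mult.assoc)
      qed
      moreover have "0 \<le> \<eta> / R\<^sup>2 * (norm y)\<^sup>2" using \<eta> by simp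
      ultimately have "\<bar>E y\<bar> \<le> \<eta> / R\<^sup>2 * (2 * norm x\<^sub>0) * norm y + \<eta> / R\<^sup>2 * r * norm y"
        using s unfolding E d by (simp add: \<theta>_def)
      also have "\<dots> = \<eta> / R\<^sup>2 * (r * r + 2 * norm x\<^sub>0 * r) * jump_weight s r y"
        using True s r by (simp add: jump_weight_inside algebra_simps)
      also have "\<dots> \<le> C * jump_weight s r y"
        using B0 r Rpos by (intro mult_right_mono jump_weight_nonneg) (simp add: C_def)
      finally show ?thesis .
    next
      case s: False
      then have "\<theta> y = 1" using True r by (auto simp: \<theta>_def)
      then have "\<bar>E y\<bar> = \<eta> / R\<^sup>2 * (r * r) * jump_weight s r y"
        using True s r \<eta> unfolding E d by (simp add: jump_weight_inside power2_eq_square)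
      also have "\<dots> \<le> C * jump_weight s r y"
        using B0 r Rpos \<eta> by (intro mult_right_mono jump_weight_nonneg) (simp add: C_def distrib_left)
      finally show ?thesis .
    qed
  next
    case False
    have yb: "\<bar>y \<bullet> b\<bar> \<le> norm y * norm b" by (rule Cauchy_Schwarz_ineq2)
    have C0: "0 \<le> \<eta> / R\<^sup>2 * (r * r + 2 * norm x\<^sub>0 * r)" using r \<eta> by simp
    have vv: "\<bar>v (x\<^sub>0 + y) - v x\<^sub>0\<bar> \<le> 2 * B" using B[of "x\<^sub>0 + y"] B[of x\<^sub>0] by linarith
    show ?thesis
    proof (cases "s \<le> 1/2")
      case s: True
      have "\<bar>(y \<bullet> b) * \<theta> y\<bar> \<le> norm b * R"
      proof (cases "norm y < R")
        case True
        then have "norm y * norm b \<le> norm b * R"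
          using mult_left_mono[of "norm y" R "norm b"] by (simp add: mult.commute)
        then show ?thesis using yb Rpos s True by (auto simp: \<theta>_def)
      next
        case False
        then show ?thesis using s Rpos by (auto simp: \<theta>_def)
      qed
      then have "\<bar>E y\<bar> \<le> C" using vv C0 r unfolding E C_def
        by (smt (verit) mult_nonneg_nonneg norm_ge_zero)
      then show ?thesis using s False r by (simp add: jump_weight_outside)
    next
      case s: False
      have "\<bar>E y\<bar> \<le> 2 * B * 1 + norm b * norm y"
        using vv yb s unfolding E by (simp add: \<theta>_def mult.commute)
      also have "\<dots> \<le> 2 * B * (norm y / r) + norm b * r * (norm y / r)"
        using B0 r False by (intro add_mono mult_left_mono) auto
      also have "\<dots> = (2 * B + norm b * r) * (norm y / r)" by (rule distrib_right[symmetric])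
      also have "\<dots> \<le> C * (norm y / r)"
        using C0 Rpos r by (intro mult_right_mono) (auto simp: C_def)
      finally show ?thesis using s False r by (simp add: jump_weight_outside)
    qed
  qed
  have EK: "integrable lebesgue (\<lambda>y. E y * K y)"
  proof (rule Bochner_Integration.integrable_bound)
    show "integrable lebesgue (\<lambda>y. C * (jump_weight s r y * K y))" using W[OF r(1)] by simp
    show "AE y in lebesgue. norm (E y * K y) \<le> norm (C * (jump_weight s r y * K y))"
    proof (rule AE_I2)
      fix y
      have "norm (E y * K y) \<le> C * jump_weight s r y * K y"
        using E_upper[of y] K0[of y] by (simp add: abs_mult mult_right_mono)
      also have "\<dots> \<le> norm (C * (jump_weight s r y * K y))" by (simp add: mult.assoc)
      finally show "norm (E y * K y) \<le> norm (C * (jump_weight s r y * K y))" .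
    qed
  qed measurable
  have Qf: "emeasure lborel Q < \<infinity>"
    using emeasure_mono[OF Q(1), of lborel] emeasure_lborel_cball_finite[of "0::'a" R]
    by (simp add: less_top[symmetric]) (metis infinity_ennreal_def neq_top_trans top.not_eq_extremum)
  have i1: "integrable lborel (\<lambda>z. indicator Q z *\<^sub>R (v z - c))"
  proof (rule Bochner_Integration.integrable_bound)
    show "integrable lborel (\<lambda>z. (B + \<bar>c\<bar>) * indicator Q z)" using Qf Q by simp
    show "AE z in lborel. norm (indicator Q z *\<^sub>R (v z - c)) \<le> norm ((B + \<bar>c\<bar>) * indicator Q z :: real)"
    proof (rule AE_I2)
      fix z show "norm (indicator Q z *\<^sub>R (v z - c)) \<le> norm ((B + \<bar>c\<bar>) * indicator Q z :: real)"
        using B[of z] by (auto simp: indicator_def)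
    qed
  qed (use Q in measurable)
  let ?f = "\<lambda>z. indicator Q z *\<^sub>R (v z - c)"
  have fm [measurable]: "?f \<in> borel_measurable borel" using Q by measurable
  have tr: "integrable lborel (\<lambda>y. ?f (x\<^sub>0 + y))" "(LINT y|lborel. ?f (x\<^sub>0 + y)) = (LINT z|lborel. ?f z)"
    using i1 integrable_distr_eq[of "(+) x\<^sub>0" lborel borel ?f] integral_distr[of "(+) x\<^sub>0" lborel borel ?f]
    by (simp_all add: lborel_distr_plus)
  have trl: "integrable lebesgue (\<lambda>y. ?f (x\<^sub>0 + y))" "(LINT y|lebesgue. ?f (x\<^sub>0 + y)) = (LINT z:Q|lborel. v z - c)"
    using tr by (simp_all add: integrable_completion integral_completion set_lebesgue_integral_def)
  have "k * (LINT z:Q|lborel. v z - c) - 2 * \<eta> * (LINT y|lebesgue. jump_weight s R y * K y)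
     = (LINT y|lebesgue. k * ?f (x\<^sub>0 + y) - 2 * \<eta> * (jump_weight s R y * K y))"
    using trl W[OF Rpos] by simp
  also have "\<dots> \<le> (LINT y|lebesgue. E y * K y)"
  proof (rule integral_mono)
    show "integrable lebesgue (\<lambda>y. k * ?f (x\<^sub>0 + y) - 2 * \<eta> * (jump_weight s R y * K y))"
      using trl W[OF Rpos] by simp
    fix y
    have "k * ?f (x\<^sub>0 + y) \<le> (v (x\<^sub>0 + y) - P (x\<^sub>0 + y)) * K y"
    proof (cases "x\<^sub>0 + y \<in> Q \<and> y \<noteq> 0")
      case True
      then have "norm (x\<^sub>0 + y) \<le> R" using Q by auto
      moreover have "norm y \<le> norm (x\<^sub>0 + y) + norm x\<^sub>0" using norm_triangle_ineq4[of "x\<^sub>0 + y" x\<^sub>0] by simp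
      ultimately have "norm y \<le> 2 * R" using x\<^sub>0 Rpos by linarith
      then have kK: "k \<le> K y" unfolding k_def
        using True \<rho> Rpos by (intro kernels_lower_bound_on_ball[OF K s(1) \<kappa> \<rho>(1)]) auto
      have "k * (v (x\<^sub>0 + y) - c) \<le> k * (v (x\<^sub>0 + y) - P (x\<^sub>0 + y))"
        using \<kappa> \<eta> by (intro mult_left_mono) (auto simp: P_def k_def)
      also have "\<dots> \<le> K y * (v (x\<^sub>0 + y) - P (x\<^sub>0 + y))"
        using below[of "x\<^sub>0 + y"] by (intro mult_right_mono kK) (simp add: P_def)
      finally show ?thesis using True by (simp add: mult.commute)
    next
      case False
      have "k * ?f (x\<^sub>0 + y) \<le> 0"
      proof (cases "y = 0")
        case True
        have "v x\<^sub>0 \<le> c" using v0 \<eta> by simp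
        then show ?thesis using True \<kappa> by (auto simp: k_def indicator_def mult_nonneg_nonpos)
      qed (use False in simp)
      also have "0 \<le> (v (x\<^sub>0 + y) - P (x\<^sub>0 + y)) * K y"
        using below[of "x\<^sub>0 + y"] K0[of y] by (intro mult_nonneg_nonneg) (auto simp: P_def)
      finally show ?thesis .
    qed
    moreover have "(v (x\<^sub>0 + y) - P (x\<^sub>0 + y) - 2 * \<eta> * jump_weight s R y) * K y \<le> E y * K y"
      by (intro mult_right_mono E_lower K0)
    ultimately show "k * ?f (x\<^sub>0 + y) - 2 * \<eta> * (jump_weight s R y * K y) \<le> E y * K y"
      by (simp add: algebra_simps)
  qed (rule EK)
  also have "\<dots> = nonlocal_op s K v x\<^sub>0"
    using nonlocal_op_eq_rescaled[OF K, of n v x\<^sub>0] EK unfolding E_def R by simp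
  finally show ?thesis unfolding k_def .
qed

section \<open>A lower barrier driven by the mean value\<close>

lemma continuous_on_if_usc_lsc:
  assumes "usc_on S u" "lsc_on S u"
  shows "continuous_on S u"
  unfolding continuous_on_def
  using assms by (auto simp: usc_on_def lsc_on_def intro!: order_tendstoI)

lemma has_vector_derivative_glue:
  assumes "0 < \<epsilon>"
  shows "((\<lambda>\<tau>. glue (cylinder \<epsilon> x\<^sub>0 t\<^sub>0) \<phi> u (x\<^sub>0, \<tau>)) has_vector_derivative D) (at_left t\<^sub>0)
    \<longleftrightarrow> ((\<lambda>\<tau>. \<phi> (x\<^sub>0, \<tau>)) has_vector_derivative D) (at_left t\<^sub>0)"
  unfolding has_real_derivative_iff_has_vector_derivative[symmetric]
proof (rule has_field_derivative_cong_eventually)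
  have "\<forall>\<^sub>F \<tau> in at_left t\<^sub>0. \<tau> \<in> {t\<^sub>0 - \<epsilon><..<t\<^sub>0}"
    using assms by (intro eventually_at_left_real) simp
  then show "\<forall>\<^sub>F \<tau> in at_left t\<^sub>0. glue (cylinder \<epsilon> x\<^sub>0 t\<^sub>0) \<phi> u (x\<^sub>0, \<tau>) = \<phi> (x\<^sub>0, \<tau>)"
    by eventually_elim (use assms in \<open>simp add: glue_def cylinder_def\<close>)
qed (use assms in \<open>simp add: glue_def cylinder_def\<close>)

text \<open>This is the heart of the proof. If the bound failed, \<open>u\<close> minus the barrier would have a negative
  minimum, attained because the barrier lies below \<open>a\<close> far out. The paraboloid without the cap is
  then an admissible test function at the minimum, and its equation compares two numbers. The time
  derivative is \<open>m'\<close>, that is, \<open>k\<close> times the mass of \<open>u - a\<close> in \<open>Q\<close>, less \<open>c\<close>. The nonlocal operator is at least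
  \<open>k\<close> times that same mass, less the costs of the paraboloid, of \<open>m\<close> and of the modification of \<open>u\<close> near
  the contact point. These costs are smaller than \<open>c\<close>.\<close>

lemma viscosity_barrier:
  fixes u :: "'a::euclidean_space \<times> real \<Rightarrow> real"
  assumes s: "0 < s" "s < 1" and \<kappa>: "0 < \<kappa>" and \<rho>: "0 \<le> \<rho>" "\<rho> \<le> R" and R: "R = 2 ^ n"
    and ne: "(kernels s \<kappa> \<Lambda> \<rho> :: ('a \<Rightarrow> real) set) \<noteq> {}"
    and W: "\<And>K r. K \<in> (kernels s \<kappa> \<Lambda> \<rho> :: ('a \<Rightarrow> real) set) \<Longrightarrow> 0 < r \<Longrightarrow> integrable lebesgue (\<lambda>y. jump_weight s r y * K y)"
    and M: "\<And>K. K \<in> (kernels s \<kappa> \<Lambda> \<rho> :: ('a \<Rightarrow> real) set) \<Longrightarrow> (LINT y|lebesgue. jump_weight s R y * K y) \<le> M"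
    and visc: "viscosity_ge (pucci_inf s \<kappa> \<Lambda> \<rho>) UNIV {..0} (\<lambda>_. 0) u"
    and cont: "continuous_on (UNIV \<times> {..0}) u"
    and u: "\<And>x t. t \<le> 0 \<Longrightarrow> a \<le> u (x, t)" "\<And>x t. t \<le> 0 \<Longrightarrow> u (x, t) \<le> a + H"
    and Q: "Q \<subseteq> cball 0 R" "compact Q" "0 < measure lborel Q"
    and \<eta>: "0 < \<eta>"
    and k: "k = \<kappa> * (2 * R) powr (- real DIM('a) - 2 * s)"
    and c: "2 * \<eta> * (k * measure lborel Q + M) < c"
    and m: "\<And>t. t \<in> {-T..0} \<Longrightarrow> (m has_real_derivative k * integral Q (\<lambda>y. u (y, t) - a) - c) (at t within {..0})"
    and mT: "m (-T) \<le> 0" and m_le: "\<And>t. t \<in> {-T..0} \<Longrightarrow> m t \<le> \<eta> / 8"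
    and t: "t \<in> {-T..0}"
  shows "a + m t - \<eta> * min 1 ((norm x / R)\<^sup>2) \<le> u (x, t)"
proof (rule ccontr)
  assume neg: "\<not> a + m t - \<eta> * min 1 ((norm x / R)\<^sup>2) \<le> u (x, t)"
  have Rpos: "0 < R" by (simp add: R)
  have H0: "0 \<le> H" using u[of 0 undefined] by simp
  define V where "V = measure lborel Q"
  have V: "0 < V" using Q by (simp add: V_def)
  define f where "f z = u z - (a + m (snd z) - \<eta> * min 1 ((norm (fst z) / R)\<^sup>2))" for z :: "'a \<times> real"
  have cm: "continuous_on {-T..0} m"
    using m has_real_derivative_imp_continuous_on[of "{-T..0}"]
    by (meson DERIV_continuous continuous_on_eq_continuous_within continuous_within_subset atLeastAtMost_iff atMost_iff subsetI)
  have "continuous_on (cball 0 R \<times> {-T..0}) f"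
    unfolding f_def
    by (intro continuous_intros continuous_on_subset[OF cont] continuous_on_compose2[OF cm]) (use Rpos in auto)
  moreover have "compact (cball (0::'a) R \<times> {-T..0})" "cball (0::'a) R \<times> {-T..0} \<noteq> {}"
    using t Rpos by (auto intro!: compact_Times)
  ultimately obtain z0 where z0: "z0 \<in> cball 0 R \<times> {-T..0}" "\<And>z. z \<in> cball 0 R \<times> {-T..0} \<Longrightarrow> f z0 \<le> f z"
    using continuous_attains_inf by metis
  obtain x\<^sub>0 t\<^sub>0 where z0_eq: "z0 = (x\<^sub>0, t\<^sub>0)" by (cases z0)
  define \<psi> where "\<psi> = f (x\<^sub>0, t\<^sub>0)"
  have t0: "t\<^sub>0 \<in> {-T..0}" using z0 z0_eq by auto
  have out: "0 \<le> f (y, \<tau>)" if "\<not> norm y \<le> R" "\<tau> \<in> {-T..0}" for y \<tau>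
  proof -
    have "1 \<le> norm y / R" using that Rpos by simp
    then have "1 \<le> (norm y / R)\<^sup>2" by simp
    then show ?thesis using u(1)[of \<tau> y] m_le[OF that(2)] that \<eta> by (simp add: f_def)
  qed
  have fxt: "f (x, t) < 0" using neg by (simp add: f_def)
  then have "norm x \<le> R" using out t by force
  then have \<psi>: "\<psi> < 0" using z0(2)[of "(x, t)"] fxt t z0_eq by (simp add: \<psi>_def)
  have f_ge: "\<psi> \<le> f (y, \<tau>)" if "\<tau> \<in> {-T..0}" for y \<tau>
    using out[OF _ that] z0(2)[of "(y, \<tau>)"] that \<psi> z0_eq unfolding \<psi>_def by fastforce
  have h0: "\<eta> * min 1 ((norm x\<^sub>0 / R)\<^sup>2) < m t\<^sub>0"
    using \<psi> u(1)[of t\<^sub>0 x\<^sub>0] t0 by (simp add: \<psi>_def f_def)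
  have "t\<^sub>0 \<noteq> -T"
  proof
    assume "t\<^sub>0 = -T"
    then have "\<eta> * min 1 ((norm x\<^sub>0 / R)\<^sup>2) < 0" using h0 mT by simp
    moreover have "0 \<le> \<eta> * min 1 ((norm x\<^sub>0 / R)\<^sup>2)" using \<eta> by simp
    ultimately show False by simp
  qed
  then have t0T: "0 < t\<^sub>0 + T" using t0 by auto
  have "\<eta> * min 1 ((norm x\<^sub>0 / R)\<^sup>2) < \<eta> * (1/8)" using h0 m_le[OF t0] by simp
  \<comment> \<open>The cap is not active at the contact point, and the cube is within reach of jumps of length \<open>2 * R\<close>.\<close>
  then have h8: "(norm x\<^sub>0 / R)\<^sup>2 < 1/8" using \<eta> by (simp add: min_less_iff_disj)
  moreover have "(1/2 :: real)\<^sup>2 = 1/4" by (simp add: power2_eq_square)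
  ultimately have "(norm x\<^sub>0 / R)\<^sup>2 \<le> (1/2)\<^sup>2" by linarith
  then have "norm x\<^sub>0 / R \<le> 1/2" by (rule power2_le_imp_le) simp
  then have x0: "norm x\<^sub>0 \<le> R / 2" using Rpos by (simp add: field_simps)
  \<comment> \<open>The test function replaces \<open>u\<close> near the contact point, where the mass of \<open>u\<close> is lost; a small ball
     makes the loss smaller than \<open>\<eta> * V\<close>.\<close>
  obtain \<epsilon> where \<epsilon>: "0 < \<epsilon>" "\<epsilon> < t\<^sub>0 + T" "\<epsilon> < R / 2" "(H + \<eta>) * measure lborel (ball x\<^sub>0 \<epsilon>) < \<eta> * V"
  proof -
    have "((\<lambda>\<epsilon>. (H + \<eta>) * (unit_ball_vol (real DIM('a)) * \<epsilon> ^ DIM('a))) \<longlongrightarrow> (H + \<eta>) * (unit_ball_vol (real DIM('a)) * 0 ^ DIM('a))) (at_right 0)"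
      by (intro tendsto_intros)
    then have "((\<lambda>\<epsilon>. (H + \<eta>) * (unit_ball_vol (real DIM('a)) * \<epsilon> ^ DIM('a))) \<longlongrightarrow> 0) (at_right 0)"
      by (simp only: zero_power[OF DIM_positive] mult_zero_right)
    then have "\<forall>\<^sub>F \<epsilon> in at_right 0. (H + \<eta>) * (unit_ball_vol (real DIM('a)) * \<epsilon> ^ DIM('a)) < \<eta> * V"
      by (rule order_tendstoD) (use \<eta> V in simp)
    moreover have "\<forall>\<^sub>F \<epsilon> in at_right 0. \<epsilon> \<in> {0<..<min (t\<^sub>0 + T) (R / 2)}"
      using t0T Rpos by (intro eventually_at_right_real) simp
    ultimately have "\<forall>\<^sub>F \<epsilon> in at_right (0::real). 0 < \<epsilon> \<and> \<epsilon> < t\<^sub>0 + T \<and> \<epsilon> < R / 2 \<and> (H + \<eta>) * (unit_ball_vol (real DIM('a)) * \<epsilon> ^ DIM('a)) < \<eta> * V"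
      by eventually_elim auto
    then obtain \<epsilon> where "0 < \<epsilon>" "\<epsilon> < t\<^sub>0 + T" "\<epsilon> < R / 2" "(H + \<eta>) * (unit_ball_vol (real DIM('a)) * \<epsilon> ^ DIM('a)) < \<eta> * V"
      using eventually_happens'[OF trivial_limit_at_right_real] by blast
    then show ?thesis using that[of \<epsilon>] by (simp add: content_ball)
  qed
  define \<phi> where "\<phi> z = a + \<psi> + m (snd z) - \<eta> * (norm (fst z) / R)\<^sup>2" for z :: "'a \<times> real"
  define v where "v = glue (cylinder \<epsilon> x\<^sub>0 t\<^sub>0) \<phi> u"
  have cyl: "(y, \<tau>) \<in> cylinder \<epsilon> x\<^sub>0 t\<^sub>0 \<Longrightarrow> \<tau> \<in> {-T..0}" for y \<tau>
    using \<epsilon> t0 by (auto simp: cylinder_def)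
  have m_left: "(m has_real_derivative k * integral Q (\<lambda>y. u (y, \<tau>) - a) - c) (at_left \<tau>)"
    if "\<tau> \<in> {-T..0}" for \<tau>
    using that by (intro DERIV_subset[OF m]) auto
  have touch: "0 \<le> parabolic_op (pucci_inf s \<kappa> \<Lambda> \<rho>) v x\<^sub>0 t\<^sub>0"
  proof -
    have "cylinder \<epsilon> x\<^sub>0 t\<^sub>0 \<subseteq> UNIV \<times> {..0}" using cyl by fastforce
    moreover have "admissible_test \<epsilon> x\<^sub>0 t\<^sub>0 \<phi>"
      unfolding admissible_test_def
    proof (intro conjI ballI)
      fix z assume "z \<in> cylinder \<epsilon> x\<^sub>0 t\<^sub>0"
      then obtain y \<tau> where z: "z = (y, \<tau>)" and \<tau>: "\<tau> \<in> {-T..0}" using cyl by (cases z) auto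
      have "((\<lambda>\<tau>. \<phi> (y, \<tau>)) has_real_derivative k * integral Q (\<lambda>y. u (y, \<tau>) - a) - c) (at_left \<tau>)"
        unfolding \<phi>_def fst_conv snd_conv by (rule derivative_eq_intros m_left[OF \<tau>] refl | simp)+
      then show "case z of (x, t) \<Rightarrow> (\<lambda>\<tau>. \<phi> (x, \<tau>)) differentiable (at_left t)"
        unfolding z by (auto simp: has_field_derivative_def intro: differentiableI)
    next
      fix \<tau>
      show "C11_on (ball x\<^sub>0 \<epsilon>) (\<lambda>x. \<phi> (x, \<tau>))"
        unfolding C11_on_def \<phi>_def fst_conv snd_conv
      proof (intro exI[of _ "\<lambda>x. - (2 * \<eta> / R\<^sup>2) *\<^sub>R x"] conjI ballI GDERIV_paraboloid exI[of _ "2 * \<eta> / R\<^sup>2"] lipschitz_onI)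
        show "dist (- (2 * \<eta> / R\<^sup>2) *\<^sub>R y) (- (2 * \<eta> / R\<^sup>2) *\<^sub>R z) \<le> 2 * \<eta> / R\<^sup>2 * dist y z" for y z :: 'a
          using \<eta> unfolding dist_norm by (simp add: norm_minus_commute flip: scaleR_diff_right)
      qed (use \<eta> in simp)
    qed
    moreover have "u (x\<^sub>0, t\<^sub>0) = \<phi> (x\<^sub>0, t\<^sub>0)"
      using h8 by (simp add: \<phi>_def \<psi>_def f_def)
    moreover have "\<phi> z \<le> u z" if "z \<in> cylinder \<epsilon> x\<^sub>0 t\<^sub>0" for z
    proof -
      obtain y \<tau> where z: "z = (y, \<tau>)" by (cases z)
      have "\<eta> * min 1 ((norm y / R)\<^sup>2) \<le> \<eta> * (norm y / R)\<^sup>2" using \<eta> by (intro mult_left_mono) auto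
      then show ?thesis using f_ge[of \<tau> y] cyl that unfolding z by (simp add: \<phi>_def f_def)
    qed
    moreover have "t\<^sub>0 \<in> {..0}" using t0 by simp
    ultimately show ?thesis
      using visc \<epsilon>(1) unfolding viscosity_ge_def v_def by blast
  qed
  define c0 where "c0 = a + \<psi> + m t\<^sub>0"
  define w where "w y = v (y, t\<^sub>0)" for y
  have w_in: "w y = c0 - \<eta> * (norm y / R)\<^sup>2" if "y \<in> ball x\<^sub>0 \<epsilon>" for y
    using that \<epsilon> by (simp add: w_def v_def glue_def cylinder_def \<phi>_def c0_def)
  have w_out: "w y = u (y, t\<^sub>0)" if "y \<notin> ball x\<^sub>0 \<epsilon>" for y
    using that by (simp add: w_def v_def glue_def cylinder_def)
  have w_below: "c0 - \<eta> * min 1 ((norm y / R)\<^sup>2) \<le> w y" for y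
  proof (cases "y \<in> ball x\<^sub>0 \<epsilon>")
    case True
    have "norm y \<le> norm x\<^sub>0 + norm (y - x\<^sub>0)" using norm_triangle_ineq[of x\<^sub>0 "y - x\<^sub>0"] by simp
    then have "norm y / R \<le> 1" using True x0 \<epsilon>(3) Rpos by (simp add: dist_norm norm_minus_commute)
    then have "(norm y / R)\<^sup>2 \<le> 1" using Rpos by (intro power_le_one) auto
    then show ?thesis by (simp add: w_in[OF True])
  next
    case False
    then show ?thesis using f_ge[OF t0, of y] by (simp add: w_out f_def c0_def)
  qed
  have u_cont: "continuous_on UNIV (\<lambda>y. u (y, t\<^sub>0))"
    by (rule continuous_on_compose2[OF cont]) (use t0 in \<open>auto intro!: continuous_intros\<close>)
  have u_meas [measurable]: "(\<lambda>y. u (y, t\<^sub>0)) \<in> borel_measurable borel"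
    using u_cont by (rule borel_measurable_continuous_onI)
  have w_meas [measurable]: "w \<in> borel_measurable borel"
  proof -
    have "w = (\<lambda>y. if y \<in> ball x\<^sub>0 \<epsilon> then c0 - \<eta> * (norm y / R)\<^sup>2 else u (y, t\<^sub>0))"
      using w_in w_out by auto
    also have "\<dots> \<in> borel_measurable borel" by (intro measurable_If_set) auto
    finally show ?thesis .
  qed
  define B where "B = \<bar>c0\<bar> + \<eta> + \<bar>a\<bar> + H"
  have w_bound: "\<bar>w y\<bar> \<le> B" for y
  proof (cases "y \<in> ball x\<^sub>0 \<epsilon>")
    case True
    have "\<eta> * min 1 ((norm y / R)\<^sup>2) \<le> \<eta> * 1" "0 \<le> \<eta> * (norm y / R)\<^sup>2" using \<eta> by auto
    then have "c0 - \<eta> \<le> w y" "w y \<le> c0" using w_below[of y] w_in[OF True] by auto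
    then show ?thesis using \<eta> H0 by (simp add: B_def)
  next
    case False
    then show ?thesis using u[of t\<^sub>0 y] t0 \<eta> by (simp add: B_def w_out)
  qed
  have Qs: "Q \<in> sets borel" using Q(2) by (simp add: borel_compact)
  have Qf: "emeasure lborel Q < \<infinity>" using Q(2) by (rule emeasure_compact_finite)
  have bf: "emeasure lborel (ball x\<^sub>0 \<epsilon>) < \<infinity>" by (rule emeasure_bounded_finite[OF bounded_ball])
  let ?A = "integral Q (\<lambda>y. u (y, t\<^sub>0) - a)"
  have si1: "set_integrable lborel Q (\<lambda>y. u (y, t\<^sub>0) - a)"
    unfolding set_integrable_def
    by (rule borel_integrable_compact[OF Q(2)]) (intro continuous_intros continuous_on_subset[OF u_cont], simp)
  have si2: "set_integrable lborel Q (\<lambda>y. \<eta> / 8)"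
    unfolding set_integrable_def using Qs Qf by (intro integrable_scaleR_left) simp
  have ib: "integrable lborel (\<lambda>y. (H + \<eta>) * indicator (ball x\<^sub>0 \<epsilon>) y)" using bf by simp
  have si3: "set_integrable lborel Q (\<lambda>y. (H + \<eta>) * indicator (ball x\<^sub>0 \<epsilon>) y)"
    unfolding set_integrable_def by (rule integrable_mult_indicator[OF _ ib]) (use Qs in simp)
  have si4: "set_integrable lborel Q (\<lambda>y. w y - c0)"
    unfolding set_integrable_def using Qs Qf w_bound
    by (intro integrableI_bounded_set_indicator[where B="B + \<bar>c0\<bar>"])
      (auto intro!: AE_I2 order_trans[OF abs_triangle_ineq4] add_mono)
  have "?A - \<eta> / 8 * V - \<eta> * V \<le> ?A - \<eta> / 8 * V - (H + \<eta>) * measure lborel (ball x\<^sub>0 \<epsilon>)"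
    using \<epsilon>(4) by linarith
  also have "\<dots> \<le> (LINT y:Q|lborel. u (y, t\<^sub>0) - a) - (LINT y:Q|lborel. \<eta> / 8)
      - (LINT y:Q|lborel. (H + \<eta>) * indicator (ball x\<^sub>0 \<epsilon>) y)"
  proof -
    have "(LINT y:Q|lborel. u (y, t\<^sub>0) - a) = ?A" using si1 by (rule set_borel_integral_eq_integral)
    moreover have "(LINT y:Q|lborel. \<eta> / 8) = \<eta> / 8 * V"
      using Qs Qf by (simp add: set_lebesgue_integral_def V_def mult.commute)
    moreover have "(LINT y:Q|lborel. (H + \<eta>) * indicator (ball x\<^sub>0 \<epsilon>) y) \<le> (LINT y|lborel. (H + \<eta>) * indicator (ball x\<^sub>0 \<epsilon>) y)"
      unfolding set_lebesgue_integral_def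
      by (rule integral_mono[OF si3[unfolded set_integrable_def] ib])
        (use H0 \<eta> in \<open>auto simp: indicator_def\<close>)
    ultimately show ?thesis using bf by simp
  qed
  also have "\<dots> = (LINT y:Q|lborel. u (y, t\<^sub>0) - a - \<eta> / 8 - (H + \<eta>) * indicator (ball x\<^sub>0 \<epsilon>) y)"
    using si1 si2 si3 by (simp add: set_integral_diff)
  also have "\<dots> \<le> (LINT y:Q|lborel. w y - c0)"
  proof (rule set_integral_mono)
    fix y
    show "u (y, t\<^sub>0) - a - \<eta> / 8 - (H + \<eta>) * indicator (ball x\<^sub>0 \<epsilon>) y \<le> w y - c0"
    proof (cases "y \<in> ball x\<^sub>0 \<epsilon>")
      case True
      have "\<eta> * min 1 ((norm y / R)\<^sup>2) \<le> \<eta> * 1" using \<eta> by (intro mult_left_mono) auto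
      then have "c0 - \<eta> \<le> w y" using w_below[of y] by linarith
      moreover have "u (y, t\<^sub>0) \<le> a + H" using u(2) t0 by simp
      ultimately show ?thesis using True \<eta> by simp
    next
      case False
      then show ?thesis using m_le[OF t0] \<psi> by (simp add: w_out c0_def)
    qed
  qed (use si1 si2 si3 si4 in \<open>auto intro!: set_integral_diff(1)\<close>)
  finally have int_ge: "?A - \<eta> / 8 * V - \<eta> * V \<le> (LINT y:Q|lborel. w y - c0)" .
  have k0: "0 < k" using \<kappa> Rpos by (simp add: k)
  have "k * (?A - \<eta> / 8 * V - \<eta> * V) - 2 * \<eta> * M \<le> pucci_inf s \<kappa> \<Lambda> \<rho> w x\<^sub>0"
    unfolding pucci_inf_def
  proof (rule cINF_greatest[OF ne])
    fix K :: "'a \<Rightarrow> real" assume K: "K \<in> kernels s \<kappa> \<Lambda> \<rho>"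
    have "k * (?A - \<eta> / 8 * V - \<eta> * V) \<le> k * (LINT y:Q|lborel. w y - c0)"
      using int_ge k0 by (intro mult_left_mono) auto
    moreover have "2 * \<eta> * (LINT y|lebesgue. jump_weight s R y * K y) \<le> 2 * \<eta> * M"
      using M[OF K] \<eta> by (intro mult_left_mono) auto
    moreover have "k * (LINT y:Q|lborel. w y - c0) - 2 * \<eta> * (LINT y|lebesgue. jump_weight s R y * K y) \<le> nonlocal_op s K w x\<^sub>0"
      unfolding k
      using nonlocal_op_ge[OF K s \<kappa> \<rho> R W[OF K] w_meas w_bound \<epsilon>(1) x0 _ w_in w_below Q(1) Qs] \<eta> by simp
    ultimately show "k * (?A - \<eta> / 8 * V - \<eta> * V) - 2 * \<eta> * M \<le> nonlocal_op s K w x\<^sub>0" by linarith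
  qed
  moreover have "vector_derivative (\<lambda>\<tau>. v (x\<^sub>0, \<tau>)) (at_left t\<^sub>0) = k * ?A - c"
  proof (rule vector_derivative_within)
    have "((\<lambda>\<tau>. \<phi> (x\<^sub>0, \<tau>)) has_real_derivative k * ?A - c) (at_left t\<^sub>0)"
      unfolding \<phi>_def fst_conv snd_conv by (rule derivative_eq_intros m_left[OF t0] refl | simp)+
    then show "((\<lambda>\<tau>. v (x\<^sub>0, \<tau>)) has_vector_derivative k * ?A - c) (at_left t\<^sub>0)"
      unfolding v_def has_vector_derivative_glue[OF \<epsilon>(1)]
      by (simp add: has_real_derivative_iff_has_vector_derivative)
  qed simp
  ultimately have "k * (?A - \<eta> / 8 * V - \<eta> * V) - 2 * \<eta> * M \<le> k * ?A - c"
    using touch unfolding parabolic_op_def w_def by linarith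
  moreover have "0 < k * \<eta> * V" using k0 \<eta> V by simp
  ultimately show False using c unfolding V_def[symmetric] by (simp add: algebra_simps)
qed

section \<open>Symmetry between subsolutions and supersolutions\<close>

lemma delta_uminus:
  assumes "GDERIV v x :> D"
  shows "delta s y (\<lambda>x. - v x) x = - delta s y v x"
proof -
  have "GDERIV (\<lambda>x. - v x) x :> - D" using assms by (rule GDERIV_minus)
  then show ?thesis using grad_eqI[OF assms] grad_eqI[of "\<lambda>x. - v x" x "- D"]
    by (simp add: delta_def algebra_simps)
qed

lemma pucci_inf_uminus:
  assumes "GDERIV v x :> D"
  shows "pucci_inf s \<kappa> \<Lambda> \<rho> (\<lambda>x. - v x) x = - pucci_sup s \<kappa> \<Lambda> \<rho> v x"
proof -
  have "nonlocal_op s K (\<lambda>x. - v x) x = - nonlocal_op s K v x" for K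
    by (simp add: nonlocal_op_def delta_uminus[OF assms])
  then show ?thesis by (simp add: pucci_inf_def pucci_sup_def Inf_real_def image_image)
qed

lemma admissible_test_uminus:
  assumes "admissible_test \<epsilon> x\<^sub>0 t\<^sub>0 \<phi>"
  shows "admissible_test \<epsilon> x\<^sub>0 t\<^sub>0 (\<lambda>z. - \<phi> z)"
  unfolding admissible_test_def
proof (intro conjI ballI)
  fix z assume "z \<in> cylinder \<epsilon> x\<^sub>0 t\<^sub>0"
  then show "case z of (x, t) \<Rightarrow> (\<lambda>\<tau>. - \<phi> (x, \<tau>)) differentiable (at_left t)"
    using assms unfolding admissible_test_def by (auto intro!: differentiable_minus)
next
  fix t assume "t \<in> {t\<^sub>0 - \<epsilon><..t\<^sub>0}"
  then obtain G C where "\<And>x. x \<in> ball x\<^sub>0 \<epsilon> \<Longrightarrow> GDERIV (\<lambda>x. \<phi> (x, t)) x :> G x" "C-lipschitz_on (ball x\<^sub>0 \<epsilon>) G"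
    using assms unfolding admissible_test_def C11_on_def by blast
  then show "C11_on (ball x\<^sub>0 \<epsilon>) (\<lambda>x. - \<phi> (x, t))"
    unfolding C11_on_def
    by (intro exI[of _ "\<lambda>x. - G x"] conjI exI[of _ C] ballI GDERIV_minus lipschitz_on_minus)
qed

lemma viscosity_le_imp_viscosity_ge_uminus:
  fixes u :: "'a::euclidean_space \<times> real \<Rightarrow> real"
  assumes "viscosity_le (pucci_sup s \<kappa> \<Lambda> \<rho>) \<Omega> I f u"
  shows "viscosity_ge (pucci_inf s \<kappa> \<Lambda> \<rho>) \<Omega> I (\<lambda>z. - f z) (\<lambda>z. - u z)"
  unfolding viscosity_ge_def
proof (intro conjI ballI allI impI)
  have "u \<in> Linfty (UNIV \<times> I)" "usc_on (\<Omega> \<times> I) u" using assms by (auto simp: viscosity_le_def)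
  then show "(\<lambda>z. - u z) \<in> Linfty (UNIV \<times> I)" by (auto simp: Linfty_def bounded_iff)
  show "lsc_on (\<Omega> \<times> I) (\<lambda>z. - u z)"
    unfolding lsc_on_def
  proof (intro ballI allI impI)
    fix z c assume "z \<in> \<Omega> \<times> I" "c < - u z"
    then have "z \<in> \<Omega> \<times> I" "u z < - c" by auto
    then have "\<forall>\<^sub>F w in at z within \<Omega> \<times> I. u w < - c"
      using \<open>usc_on (\<Omega> \<times> I) u\<close> unfolding usc_on_def by blast
    then show "\<forall>\<^sub>F w in at z within \<Omega> \<times> I. c < - u w" by eventually_elim simp
  qed
next
  fix x\<^sub>0 t\<^sub>0 and \<epsilon> :: real and \<phi>
  assume x0: "x\<^sub>0 \<in> \<Omega>" "t\<^sub>0 \<in> I" and \<epsilon>: "0 < \<epsilon>"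
    and *: "cylinder \<epsilon> x\<^sub>0 t\<^sub>0 \<subseteq> \<Omega> \<times> I \<and> admissible_test \<epsilon> x\<^sub>0 t\<^sub>0 \<phi> \<and> - u (x\<^sub>0, t\<^sub>0) = \<phi> (x\<^sub>0, t\<^sub>0) \<and>
       (\<forall>z\<in>cylinder \<epsilon> x\<^sub>0 t\<^sub>0. \<phi> z \<le> - u z)"
  let ?Q = "cylinder \<epsilon> x\<^sub>0 t\<^sub>0"
  define v where "v = glue ?Q (\<lambda>z. - \<phi> z) u"
  have neg: "glue ?Q \<phi> (\<lambda>z. - u z) = (\<lambda>z. - v z)" by (auto simp: glue_def v_def)
  have "parabolic_op (pucci_sup s \<kappa> \<Lambda> \<rho>) v x\<^sub>0 t\<^sub>0 \<le> f (x\<^sub>0, t\<^sub>0)"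
    using assms x0 \<epsilon> * admissible_test_uminus[of \<epsilon> x\<^sub>0 t\<^sub>0 \<phi>] unfolding viscosity_le_def v_def
    by (smt (verit, ccfv_threshold))
  moreover
  have t0: "t\<^sub>0 \<in> {t\<^sub>0 - \<epsilon><..t\<^sub>0}" "(x\<^sub>0, t\<^sub>0) \<in> ?Q" using \<epsilon> by (auto simp: cylinder_def)
  have adm: "admissible_test \<epsilon> x\<^sub>0 t\<^sub>0 (\<lambda>z. - \<phi> z)" using * admissible_test_uminus by blast
  obtain D where "GDERIV (\<lambda>x. - \<phi> (x, t\<^sub>0)) x\<^sub>0 :> D"
    using adm t0(1) \<epsilon> unfolding admissible_test_def C11_on_def by (meson centre_in_ball)
  then have "GDERIV (\<lambda>x. v (x, t\<^sub>0)) x\<^sub>0 :> D"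
    by (rule GDERIV_transform_within_open[of _ _ _ "ball x\<^sub>0 \<epsilon>"]) (use \<epsilon> in \<open>auto simp: v_def glue_def cylinder_def\<close>)
  note P = pucci_inf_uminus[OF this]
  have "(\<lambda>\<tau>. - \<phi> (x\<^sub>0, \<tau>)) differentiable (at_left t\<^sub>0)"
    using adm t0(2) unfolding admissible_test_def by blast
  then obtain E where "((\<lambda>\<tau>. - \<phi> (x\<^sub>0, \<tau>)) has_vector_derivative E) (at_left t\<^sub>0)"
    using vector_derivative_works by blast
  then have "((\<lambda>\<tau>. v (x\<^sub>0, \<tau>)) has_vector_derivative E) (at_left t\<^sub>0)"
    unfolding v_def has_vector_derivative_glue[OF \<epsilon>] .
  then have "vector_derivative (\<lambda>\<tau>. v (x\<^sub>0, \<tau>)) (at_left t\<^sub>0) = E"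
    "vector_derivative (\<lambda>\<tau>. - v (x\<^sub>0, \<tau>)) (at_left t\<^sub>0) = - E"
    by (auto intro!: vector_derivative_within has_vector_derivative_minus)
  ultimately show "- f (x\<^sub>0, t\<^sub>0) \<le> parabolic_op (pucci_inf s \<kappa> \<Lambda> \<rho>) (glue ?Q \<phi> (\<lambda>z. - u z)) x\<^sub>0 t\<^sub>0"
    unfolding neg parabolic_op_def by (simp add: P)
qed

section \<open>Improvement of the lower bound\<close>

text \<open>The side length makes the cube fit into the ball of radius \<open>R\<close>. A cube is a \<^const>\<open>cbox\<close>, over which
  the integral of a jointly continuous function is continuous in the parameter.\<close>

definition centred_cube :: "real \<Rightarrow> 'a::euclidean_space set" where
  "centred_cube R = cbox (- (R / DIM('a)) *\<^sub>R One) ((R / DIM('a)) *\<^sub>R One)"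

lemma centred_cube_subset_cball: "centred_cube R \<subseteq> cball (0::'a::euclidean_space) R"
proof
  fix x :: 'a assume x: "x \<in> centred_cube R"
  have "norm x \<le> (\<Sum>i\<in>Basis. \<bar>x \<bullet> i\<bar>)" by (rule norm_le_l1)
  also have "\<dots> \<le> (\<Sum>i\<in>(Basis::'a set). R / DIM('a))"
    using x by (intro sum_mono) (auto simp: centred_cube_def mem_box abs_le_iff minus_le_iff)
  also have "\<dots> = R" by simp
  finally show "x \<in> cball 0 R" by simp
qed

lemma measure_centred_cube:
  "0 \<le> R \<Longrightarrow> measure lborel (centred_cube R :: 'a::euclidean_space set) = (2 * R / DIM('a)) ^ DIM('a)"
  by (simp add: centred_cube_def content_cbox_if box_eq_empty inner_diff_left divide_less_0_iff)

definition space_time_mean_ge ::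
    "real \<Rightarrow> real \<Rightarrow> real \<Rightarrow> ('a::euclidean_space \<times> real \<Rightarrow> real) \<Rightarrow> bool" where
  "space_time_mean_ge R T h (u :: 'a \<times> real \<Rightarrow> real) \<longleftrightarrow>
     h * measure lborel (centred_cube R :: 'a set) * T
       \<le> integral {-T..0} (\<lambda>t. integral (centred_cube R) (\<lambda>y. u (y, t)))"

lemma continuous_on_cube_integral:
  fixes u :: "'a::euclidean_space \<times> real \<Rightarrow> real"
  assumes "continuous_on (UNIV \<times> {..0}) u" "S \<subseteq> {..0}"
  shows "continuous_on S (\<lambda>t. integral (centred_cube R) (\<lambda>y. u (y, t) - a))"
  unfolding centred_cube_def
proof (rule integral_continuous_on_param)
  have "continuous_on (S \<times> cbox (- (R / DIM('a)) *\<^sub>R One) ((R / DIM('a)) *\<^sub>R One)) (\<lambda>z. u (snd z, fst z) - a)"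
    by (intro continuous_intros continuous_on_compose2[OF assms(1)]) (use assms(2) in auto)
  then show "continuous_on (S \<times> cbox (- (R / DIM('a)) *\<^sub>R One) ((R / DIM('a)) *\<^sub>R One)) (\<lambda>(t, y). u (y, t) - a)"
    by (simp add: case_prod_unfold)
qed

text \<open>The barrier is run on the parabolic cylinder of radius \<open>R\<close> with the constants at their natural sizes.
  By scaling, \<open>k\<close> times the volume of the cube is \<open>g * R powr (- 2 * s)\<close>. The drift \<open>c\<close> is a
  multiple of \<open>\<eta>\<close> just large enough for the barrier lemma, and \<open>\<eta>\<close> is so small that \<open>c\<close> is a quarter
  of \<open>g * H * R powr (- 2 * s)\<close>, hence half of what a mean value of \<open>H / 2\<close> supplies.
  The duration \<open>\<tau>\<close> is so short that \<open>m\<close> stays below \<open>\<eta> / 8\<close>. What remains is \<open>m 0 \<ge> \<eta> / 32\<close>, with neither \<open>\<eta>\<close>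
  nor \<open>\<tau>\<close> depending on \<open>R\<close>. The other two terms of the bound are errors that vanish as \<open>R\<close> grows.\<close>

lemma lower_bound_at_scale:
  fixes u :: "'a::euclidean_space \<times> real \<Rightarrow> real"
  assumes s: "0 < s" "s < 1" and \<kappa>: "0 < \<kappa>" and \<rho>: "0 \<le> \<rho>" "\<rho> \<le> R" and R: "R = 2 ^ n"
    and ne: "(kernels s \<kappa> \<Lambda> \<rho> :: ('a \<Rightarrow> real) set) \<noteq> {}"
    and C: "0 \<le> C" "\<forall>K \<in> (kernels s \<kappa> \<Lambda> \<rho> :: ('a \<Rightarrow> real) set). \<forall>r>0.
       integrable lebesgue (\<lambda>y. jump_weight s r y * K y) \<and>
       (LINT y|lebesgue. jump_weight s r y * K y) \<le> C * r powr (- 2 * s)"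
    and visc: "viscosity_ge (pucci_inf s \<kappa> \<Lambda> \<rho>) UNIV {..0} (\<lambda>_. 0) u"
    and cont: "continuous_on (UNIV \<times> {..0}) u"
    and H: "0 < H" and u: "\<And>x t. t \<le> 0 \<Longrightarrow> a \<le> u (x, t)" "\<And>x t. t \<le> 0 \<Longrightarrow> u (x, t) \<le> a + H"
    and g: "g = \<kappa> * 2 powr (- real DIM('a) - 2 * s) * (2 / DIM('a)) ^ DIM('a)"
    and \<eta>: "\<eta> = g * H / (4 * (2 * C + 2 * g + 1))"
    and \<tau>: "\<tau> = \<eta> / (8 * g * H)"
    and T: "T = \<tau> * R powr (2 * s)"
    and mean: "space_time_mean_ge R T (H / 2) (\<lambda>z. u z - a)"
    and t: "t \<in> {-T..0}"
  shows "a + \<eta> / 32 + t * (g * H * R powr (- 2 * s)) - \<eta> * (norm x / R)\<^sup>2 \<le> u (x, t)"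
proof -
  define Q where "Q = (centred_cube R :: 'a set)"
  define V where "V = measure lborel Q"
  define k where "k = \<kappa> * (2 * R) powr (- real DIM('a) - 2 * s)"
  define A where "A t = integral Q (\<lambda>y. u (y, t) - a)" for t
  define \<theta> where "\<theta> = R powr (- 2 * s)"
  define c where "c = \<eta> * (2 * C + 2 * g + 1) * \<theta>"
  have Rpos: "0 < R" by (simp add: R)
  have gpos: "0 < g" using \<kappa> by (simp add: g)
  have \<theta>pos: "0 < \<theta>" using Rpos by (simp add: \<theta>_def)
  have pos: "0 < 2 * C + 2 * g + 1" using C gpos by simp
  have \<eta>pos: "0 < \<eta>" using gpos H pos by (simp add: \<eta>)
  have Tpos: "0 < T" using \<eta>pos gpos H Rpos by (simp add: T \<tau>)
  have V_eq: "V = (2 * R / DIM('a)) ^ DIM('a)"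
    unfolding V_def Q_def using Rpos by (intro measure_centred_cube) simp
  then have Vpos: "0 < V" using Rpos by simp
  have Qc: "Q \<subseteq> cball 0 R" "compact Q" unfolding Q_def
    by (rule centred_cube_subset_cball) (simp add: centred_cube_def)
  have kV: "k * V = g * \<theta>"
  proof -
    have "(2 * R) powr (- real DIM('a) - 2 * s) = 2 powr (- real DIM('a) - 2 * s) * (inverse (R ^ DIM('a)) * \<theta>)"
      using Rpos by (simp add: powr_mult powr_diff powr_minus powr_realpow \<theta>_def divide_inverse)
    moreover have "(2 * R / DIM('a)) ^ DIM('a) = (2 / DIM('a)) ^ DIM('a) * R ^ DIM('a)"
      by (simp add: power_mult_distrib[symmetric])
    ultimately show ?thesis unfolding k_def V_eq g using Rpos by (simp add: field_simps)
  qed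
  have \<theta>T: "\<theta> * T = \<tau>" using Rpos by (simp add: \<theta>_def T powr_minus)
  have gH\<tau>: "g * H * \<tau> = \<eta> / 8" using gpos H by (simp add: \<tau>)
  have "g * H / (4 * P) * P = g * H / 4" if "0 < P" for P using that by simp
  from this[OF pos] have c_eq: "c = g * H / 4 * \<theta>" by (simp only: c_def \<eta>)
  have cpos: "0 \<le> c" using gpos H \<theta>pos by (simp add: c_eq)
  have A_cont: "continuous_on S A" if "S \<subseteq> {..0}" for S
    unfolding A_def Q_def using cont that by (rule continuous_on_cube_integral)
  have A_le: "A t \<le> H * V" if "t \<le> 0" for t
  proof -
    have "continuous_on Q (\<lambda>y. u (y, t) - a)"
      by (intro continuous_intros continuous_on_compose2[OF cont]) (use that in auto)
    then have "A t \<le> integral Q (\<lambda>_. H)" unfolding A_def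
      using u(2)[OF that] unfolding Q_def centred_cube_def
      by (intro integral_le integrable_continuous integrable_const) (auto simp: algebra_simps)
    also have "\<dots> = H * V" by (simp add: Q_def V_def centred_cube_def)
    finally show ?thesis .
  qed
  have "continuous_on {-T-1..0} (\<lambda>t. k * A t - c)"
    by (intro continuous_intros A_cont) auto
  then obtain G where G: "\<And>t. t \<in> {-T-1..0} \<Longrightarrow> (G has_vector_derivative k * A t - c) (at t within {-T-1..0})"
    using antiderivative_continuous by blast
  define m where "m t = G t - G (-T)" for t
  have m_vd: "(m has_vector_derivative k * A t - c) (at t within {-T-1..0})" if "t \<in> {-T..0}" for t
    unfolding m_def using has_vector_derivative_diff_const[of G "G (-T)"] G[of t] that by simp
  have m: "(m has_real_derivative k * A t - c) (at t within {..0})" if "t \<in> {-T..0}" for t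
  proof -
    have "at t within {-T-1..0} = at t within {..0}"
      using that by (intro at_within_nhd[of _ "{-T-1<..}"]) auto
    then show ?thesis using m_vd[OF that] by (simp add: has_real_derivative_iff_has_vector_derivative)
  qed
  have ftc: "((\<lambda>t. k * A t - c) has_integral m \<beta> - m \<alpha>) {\<alpha>..\<beta>}" if "-T \<le> \<alpha>" "\<alpha> \<le> \<beta>" "\<beta> \<le> 0" for \<alpha> \<beta>
    using that(2)
  proof (rule fundamental_theorem_of_calculus)
    fix t assume "t \<in> {\<alpha>..\<beta>}"
    then show "(m has_vector_derivative k * A t - c) (at t within {\<alpha>..\<beta>})"
      using that by (intro has_vector_derivative_within_subset[OF m_vd]) auto
  qed
  have kpos: "0 < k" using \<kappa> Rpos by (simp add: k_def)
  have slope: "m \<beta> - m \<alpha> \<le> g * H * \<theta> * (\<beta> - \<alpha>)" if "-T \<le> \<alpha>" "\<alpha> \<le> \<beta>" "\<beta> \<le> 0" for \<alpha> \<beta>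
  proof (rule has_integral_le[OF ftc[OF that]])
    show "((\<lambda>_. g * H * \<theta>) has_integral g * H * \<theta> * (\<beta> - \<alpha>)) {\<alpha>..\<beta>}"
      using has_integral_const_real[of "g * H * \<theta>" \<alpha> \<beta>] that by (simp add: mult.commute)
    fix t assume "t \<in> {\<alpha>..\<beta>}"
    then have "k * A t \<le> k * (H * V)" using kpos that by (intro mult_left_mono A_le) auto
    also have "\<dots> = g * H * \<theta>" using kV by (simp add: mult_ac)
    finally show "k * A t - c \<le> g * H * \<theta>" using cpos by simp
  qed
  have mT: "m (-T) = 0" by (simp add: m_def)
  have m_le: "m t \<le> \<eta> / 8" if "t \<in> {-T..0}" for t
  proof -
    have "m t \<le> g * H * \<theta> * (t + T)" using slope[of "-T" t] that mT by simp
    also have "\<dots> \<le> g * H * \<theta> * T" using gpos H \<theta>pos that by (intro mult_left_mono) auto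
    also have "\<dots> = \<eta> / 8" using \<theta>T gH\<tau> by (simp add: mult.assoc)
    finally show ?thesis .
  qed
  have m0: "\<eta> / 32 \<le> m 0"
  proof -
    have A_int: "A integrable_on {-T..0}" by (intro integrable_continuous_real A_cont) auto
    have "m 0 = integral {-T..0} (\<lambda>t. k * A t - c)"
      using integral_unique[OF ftc[of "-T" 0]] Tpos mT by simp
    also have "\<dots> = k * integral {-T..0} A - c * T"
      using A_int Tpos by (subst Henstock_Kurzweil_Integration.integral_diff) (auto intro: integrable_on_mult_right)
    also have "\<dots> \<ge> k * (H / 2 * V * T) - c * T"
      using mean kpos unfolding space_time_mean_ge_def A_def[abs_def] V_def Q_def
      by (intro diff_right_mono mult_left_mono) auto
    also have "k * (H / 2 * V * T) - c * T = g * H / 4 * (\<theta> * T)"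
    proof -
      have "k * (H / 2 * V * T) = (k * V) * (H / 2 * T)" by simp
      then show ?thesis unfolding kV c_eq by (simp add: algebra_simps)
    qed
    also have "\<dots> = \<eta> / 32"
    proof -
      have "g * H / 4 * \<tau> = (g * H * \<tau>) / 4" by simp
      then show ?thesis unfolding \<theta>T gH\<tau> by simp
    qed
    finally show ?thesis .
  qed
  have "a + m t - \<eta> * min 1 ((norm x / R)\<^sup>2) \<le> u (x, t)"
  proof (rule viscosity_barrier[OF s \<kappa> \<rho> R ne _ _ visc cont u Qc _ \<eta>pos k_def _ _ _ _ t])
    show "2 * \<eta> * (k * measure lborel Q + C * \<theta>) < c"
      using \<eta>pos \<theta>pos unfolding V_def[symmetric] kV c_def by (simp add: algebra_simps)
    show "(LINT y|lebesgue. jump_weight s R y * K y) \<le> C * \<theta>" if "K \<in> kernels s \<kappa> \<Lambda> \<rho>" for K :: "'a \<Rightarrow> real"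
      using C(2) that Rpos by (simp add: \<theta>_def)
  qed (use C(2) Vpos m mT m_le in \<open>auto simp: V_def A_def\<close>)
  moreover have "\<eta> * min 1 ((norm x / R)\<^sup>2) \<le> \<eta> * (norm x / R)\<^sup>2" using \<eta>pos by (intro mult_left_mono) auto
  moreover have "m 0 + t * (g * H * \<theta>) \<le> m t" using slope[of t 0] t by (simp add: algebra_simps)
  ultimately show ?thesis using m0 unfolding \<theta>_def by linarith
qed

text \<open>Let \<open>R \<rightarrow> \<infinity>\<close> in the previous bound along the scales with a large mean value: a fixed point
  \<open>(x, t)\<close> becomes indistinguishable from the origin. The gain \<open>\<delta>\<close> and the duration \<open>\<tau>\<close> are the same
  for all solutions, so that they serve \<open>u\<close> and \<open>- u\<close> at once.\<close>

lemma viscosity_improvement: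
  assumes s: "0 < s" "s < 1" and \<kappa>: "0 < \<kappa>" and \<Lambda>: "0 \<le> \<Lambda>" and \<rho>: "0 \<le> \<rho>" and H: "0 < H"
    and ne: "(kernels s \<kappa> \<Lambda> \<rho> :: ('a::euclidean_space \<Rightarrow> real) set) \<noteq> {}"
  obtains \<tau> \<delta> where "0 < \<tau>" "0 < \<delta>"
    "\<And>u :: 'a \<times> real \<Rightarrow> real. \<And>a x t. viscosity_ge (pucci_inf s \<kappa> \<Lambda> \<rho>) UNIV {..0} (\<lambda>_. 0) u \<Longrightarrow>
      continuous_on (UNIV \<times> {..0}) u \<Longrightarrow> u ` (UNIV \<times> {..0}) \<subseteq> {a..a + H} \<Longrightarrow>
      \<exists>\<^sub>F n in sequentially. space_time_mean_ge (2 ^ n) (\<tau> * (2 ^ n) powr (2 * s)) (H / 2) (\<lambda>z. u z - a) \<Longrightarrow>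
      t \<le> 0 \<Longrightarrow> a + \<delta> \<le> u (x, t)"
proof -
  obtain C where C: "0 \<le> C" "\<forall>K \<in> (kernels s \<kappa> \<Lambda> \<rho> :: ('a \<Rightarrow> real) set). \<forall>r>0.
       integrable lebesgue (\<lambda>y. jump_weight s r y * K y) \<and>
       (LINT y|lebesgue. jump_weight s r y * K y) \<le> C * r powr (- 2 * s)"
    using kernels_jump_weight[OF s \<Lambda>] by blast
  define g where "g = \<kappa> * 2 powr (- real DIM('a) - 2 * s) * (2 / DIM('a)) ^ DIM('a)"
  define \<eta> where "\<eta> = g * H / (4 * (2 * C + 2 * g + 1))"
  define \<tau> where "\<tau> = \<eta> / (8 * g * H)"
  have gpos: "0 < g" using \<kappa> by (simp add: g_def)
  have \<eta>pos: "0 < \<eta>" using gpos H C(1) by (simp add: \<eta>_def)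
  have \<tau>pos: "0 < \<tau>" using \<eta>pos gpos H by (simp add: \<tau>_def)
  show ?thesis
  proof (rule that[OF \<tau>pos, of "\<eta> / 32"])
    show "0 < \<eta> / 32" using \<eta>pos by simp
    fix u :: "'a \<times> real \<Rightarrow> real" and a t :: real and x :: 'a
    assume visc: "viscosity_ge (pucci_inf s \<kappa> \<Lambda> \<rho>) UNIV {..0} (\<lambda>_. 0) u"
      and cont: "continuous_on (UNIV \<times> {..0}) u" and im: "u ` (UNIV \<times> {..0}) \<subseteq> {a..a + H}"
      and mean: "\<exists>\<^sub>F n in sequentially. space_time_mean_ge (2 ^ n) (\<tau> * (2 ^ n) powr (2 * s)) (H / 2) (\<lambda>z. u z - a)"
      and t: "t \<le> 0"
    have u: "a \<le> u (x, t)" "u (x, t) \<le> a + H" if "t \<le> 0" for x :: 'a and t :: real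
      using im that by (force simp: image_subset_iff)+
    show "a + \<eta> / 32 \<le> u (x, t)"
    proof (rule ccontr)
      assume "\<not> a + \<eta> / 32 \<le> u (x, t)"
      then have less: "u (x, t) < a + \<eta> / 32" by simp
      have R: "filterlim (\<lambda>n. 2 ^ n :: real) at_top sequentially"
        by (intro filterlim_at_infinity_imp_filterlim_at_top filterlim_realpow_sequentially_gt1) auto
      have \<theta>: "(\<lambda>n. (2 ^ n :: real) powr (- 2 * s)) \<longlonglongrightarrow> 0"
        using s R by (intro tendsto_neg_powr) auto
      have "(\<lambda>n. norm x / 2 ^ n) \<longlonglongrightarrow> 0"
        using R by (intro real_tendsto_divide_at_top[OF tendsto_const])
      with \<theta> have "(\<lambda>n. a + \<eta> / 32 + t * (g * H * (2 ^ n) powr (- 2 * s)) - \<eta> * (norm x / 2 ^ n)\<^sup>2)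
          \<longlonglongrightarrow> a + \<eta> / 32 + t * (g * H * 0) - \<eta> * 0\<^sup>2"
        by (intro tendsto_intros)
      then have "\<forall>\<^sub>F n in sequentially. u (x, t) <
          a + \<eta> / 32 + t * (g * H * (2 ^ n) powr (- 2 * s)) - \<eta> * (norm x / 2 ^ n)\<^sup>2"
        using less by (intro order_tendstoD) auto
      moreover have "(\<lambda>n. (2 ^ n :: real) powr (- 2 * s) * (- t)) \<longlonglongrightarrow> 0"
        by (rule tendsto_mult_left_zero[OF \<theta>])
      then have "\<forall>\<^sub>F n in sequentially. (2 ^ n :: real) powr (- 2 * s) * (- t) < \<tau>"
        using \<tau>pos by (rule order_tendstoD)
      moreover have "\<forall>\<^sub>F n in sequentially. \<rho> \<le> 2 ^ n"
        using R by (simp add: filterlim_at_top)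
      ultimately have "\<forall>\<^sub>F n in sequentially. \<rho> \<le> 2 ^ n \<and> (2 ^ n :: real) powr (- 2 * s) * (- t) < \<tau> \<and>
        u (x, t) < a + \<eta> / 32 + t * (g * H * (2 ^ n) powr (- 2 * s)) - \<eta> * (norm x / 2 ^ n)\<^sup>2"
        by eventually_elim simp
      then obtain n where n: "\<rho> \<le> 2 ^ n" "(2 ^ n :: real) powr (- 2 * s) * (- t) < \<tau>"
        "u (x, t) < a + \<eta> / 32 + t * (g * H * (2 ^ n) powr (- 2 * s)) - \<eta> * (norm x / 2 ^ n)\<^sup>2"
        and mean_n: "space_time_mean_ge (2 ^ n) (\<tau> * (2 ^ n) powr (2 * s)) (H / 2) (\<lambda>z. u z - a)"
        using frequently_ex[OF frequently_eventually_frequently[OF mean]] by blast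
      have "- t \<le> \<tau> * (2 ^ n) powr (2 * s)"
        using n(2) by (simp add: powr_minus field_simps)
      then have "t \<in> {- (\<tau> * (2 ^ n) powr (2 * s))..0}" using t by simp
      from lower_bound_at_scale[OF s \<kappa> \<rho> n(1) refl ne C visc cont H u g_def \<eta>_def \<tau>_def refl mean_n this, of x] n(3)
      show False by simp
    qed
  qed
qed

section \<open>The Liouville theorem\<close>

theorem proposition3p5:
  fixes s \<kappa> \<Lambda> \<rho> :: real
    and u :: "(real ^ 'n) \<times> real \<Rightarrow> real"
  assumes "0 < s" and "s < 1"
    and "0 < \<kappa>" and "0 < \<Lambda>" and "0 \<le> \<rho>"
    and "(kernels s \<kappa> \<Lambda> \<rho> :: (real ^ 'n \<Rightarrow> real) set) \<noteq> {}"
    and "u \<in> Linfty (UNIV \<times> {..0})"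
    and "viscosity_le (pucci_sup s \<kappa> \<Lambda> \<rho>) UNIV {..0} (\<lambda>_. 0) u"
    and "viscosity_ge (pucci_inf s \<kappa> \<Lambda> \<rho>) UNIV {..0} (\<lambda>_. 0) u"
  shows "u constant_on (UNIV \<times> {..0})"
proof -
  let ?S = "UNIV \<times> {..0} :: ((real ^ 'n) \<times> real) set"
  define a where "a = Inf (u ` ?S)"
  define b where "b = Sup (u ` ?S)"
  have bd: "bdd_below (u ` ?S)" "bdd_above (u ` ?S)"
    using assms(7) bounded_imp_bdd_below bounded_imp_bdd_above by (auto simp: Linfty_def)
  have ab: "a \<le> u z" "u z \<le> b" if "z \<in> ?S" for z
    using that bd by (auto simp: a_def b_def intro!: cInf_lower cSup_upper)
  have S0: "u ` ?S \<noteq> {}" by auto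
  have cont: "continuous_on ?S u"
    using assms(8,9) by (intro continuous_on_if_usc_lsc) (auto simp: viscosity_le_def viscosity_ge_def)
  have visc: "viscosity_ge (pucci_inf s \<kappa> \<Lambda> \<rho>) UNIV {..0} (\<lambda>_. 0) (\<lambda>z. - u z)"
    using viscosity_le_imp_viscosity_ge_uminus[OF assms(8)] by simp
  have "b \<le> a"
  proof (rule ccontr)
    assume "\<not> b \<le> a"
    then have H: "0 < b - a" by simp
    obtain \<tau> \<delta> where \<tau>: "0 < \<tau>" and \<delta>: "0 < \<delta>" and improve:
      "\<And>u :: (real ^ 'n) \<times> real \<Rightarrow> real. \<And>c x t. viscosity_ge (pucci_inf s \<kappa> \<Lambda> \<rho>) UNIV {..0} (\<lambda>_. 0) u \<Longrightarrow>
        continuous_on ?S u \<Longrightarrow> u ` ?S \<subseteq> {c..c + (b - a)} \<Longrightarrow>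
        \<exists>\<^sub>F n in sequentially. space_time_mean_ge (2 ^ n) (\<tau> * (2 ^ n) powr (2 * s)) ((b - a) / 2) (\<lambda>z. u z - c) \<Longrightarrow>
        t \<le> 0 \<Longrightarrow> c + \<delta> \<le> u (x, t)"
      by (rule viscosity_improvement[OF assms(1-3) less_imp_le[OF assms(4)] assms(5) H assms(6)]) blast
    define lower where "lower n \<longleftrightarrow> space_time_mean_ge (2 ^ n) (\<tau> * (2 ^ n) powr (2 * s)) ((b - a) / 2) (\<lambda>z. u z - a)" for n
    define upper where "upper n \<longleftrightarrow> space_time_mean_ge (2 ^ n) (\<tau> * (2 ^ n) powr (2 * s)) ((b - a) / 2) (\<lambda>z. - u z - (- b))" for n
    \<comment> \<open>\<open>u - a\<close> and \<open>b - u\<close> add up to \<open>b - a\<close>, so one of them has mean at least \<open>(b - a) / 2\<close>.\<close>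
    have "lower n \<or> upper n" for n
    proof -
      let ?Q = "centred_cube (2 ^ n) :: (real ^ 'n) set" and ?T = "\<tau> * (2 ^ n) powr (2 * s)"
      let ?A = "\<lambda>t. integral ?Q (\<lambda>y. u (y, t) - a)" and ?B = "\<lambda>t. integral ?Q (\<lambda>y. - u (y, t) - (- b))"
      have T: "0 < ?T" using \<tau> by simp
      have AB: "?A t + ?B t = (b - a) * measure lborel ?Q" if "t \<le> 0" for t
      proof -
        have "continuous_on ?Q (\<lambda>y. u (y, t))"
          by (intro continuous_on_compose2[OF cont] continuous_intros) (use that in auto)
        then have "(\<lambda>y. u (y, t) - a) integrable_on ?Q" "(\<lambda>y. - u (y, t) - (- b)) integrable_on ?Q"
          unfolding centred_cube_def by (auto intro!: integrable_continuous continuous_intros)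
        then have "?A t + ?B t = integral ?Q (\<lambda>y. (u (y, t) - a) + (- u (y, t) - (- b)))"
          by (rule Henstock_Kurzweil_Integration.integral_add[symmetric])
        also have "\<dots> = integral ?Q (\<lambda>_. b - a)" by simp
        also have "\<dots> = (b - a) * measure lborel ?Q" by (simp add: centred_cube_def)
        finally show ?thesis .
      qed
      have "?A integrable_on {-?T..0}" "?B integrable_on {-?T..0}"
        using continuous_on_cube_integral[OF cont, of "{-?T..0}" "2 ^ n" a]
          continuous_on_cube_integral[OF continuous_on_minus[OF cont], of "{-?T..0}" "2 ^ n" "- b"]
        by (auto intro!: integrable_continuous_real)
      then have "integral {-?T..0} ?A + integral {-?T..0} ?B = integral {-?T..0} (\<lambda>t. ?A t + ?B t)"
        by (rule Henstock_Kurzweil_Integration.integral_add[symmetric])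
      also have "\<dots> = integral {-?T..0} (\<lambda>t. (b - a) * measure lborel ?Q)"
        using AB by (intro Henstock_Kurzweil_Integration.integral_cong) auto
      also have "\<dots> = 2 * ((b - a) / 2 * measure lborel ?Q * ?T)" using T by simp
      finally show ?thesis unfolding lower_def upper_def space_time_mean_ge_def by argo
    qed
    then have "\<exists>\<^sub>F n in sequentially. lower n \<or> upper n" by (simp)
    then consider "\<exists>\<^sub>F n in sequentially. lower n" | "\<exists>\<^sub>F n in sequentially. upper n"
      unfolding frequently_disj_iff by blast
    then show False
    proof cases
      case 1
      have "a + \<delta> \<le> u (x, t)" if "t \<le> 0" for x t
        by (rule improve[OF assms(9) cont _ 1[unfolded lower_def] that]) (use ab in force)
      then have "a + \<delta> \<le> a" unfolding a_def by (intro cInf_greatest[OF S0]) (auto simp: a_def)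
      then show False using \<delta> by simp
    next
      case 2
      have "- b + \<delta> \<le> - u (x, t)" if "t \<le> 0" for x t
        by (rule improve[OF visc continuous_on_minus[OF cont] _ 2[unfolded upper_def] that]) (use ab in force)
      then have "u (x, t) \<le> b - \<delta>" if "t \<le> 0" for x t using that by (smt (verit))
      then have "b \<le> b - \<delta>" unfolding b_def by (intro cSup_least[OF S0]) (auto simp: b_def)
      then show False using \<delta> by simp
    qed
  qed
  then have "u z = a" if "z \<in> ?S" for z using ab[OF that] by simp
  then show ?thesis unfolding constant_on_def by blast
qed

end
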